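(* Let $N\ge 2$, let $G=([N-1],E,(\omega_{x,y})_{\{x,y\}\in E})$ be a finite connected graph with symmetric conductances $\omega_{x,y}\in(0,\infty)$, and let $\rho_L,\rho_R\in(0,1)$, $\omega_L,\omega_R>0$. The stationary distribution of the boundary driven symmetric exclusion process on $G$ with reservoir parameters $\rho_L,\rho_R,\omega_L,\omega_R$ is $$\mu_{\mathrm{stat}}=\sum_{I\in\mathcal P([N-1])}F(I)\,\Big(\bigotimes_{x\in I}\mathrm{Bernoulli}(\rho_R)\ \bigotimes_{y\in[N-1]\setminus I}\mathrm{Bernoulli}(\rho_L)\Big),$$ where, for every $I\in\mathcal P([N-1])$, $$F(I):=\sum_{J\in\mathcal P([N-1]):\ I\subset J}(-1)^{|J\setminus I|}\,\hat{\mathbb P}_J\big(\xi_\infty(N)=|J|\big)>0,$$ and $$\sum_{I\in\mathcal P([N-1])}F(I)=1.$$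
   Context: $[N-1]:=\{1,\dots,N-1\}$; $\mathcal P(A)$ is the power set of $A$; $|J|$ is the cardinality of $J$. Boundary driven SEP: the continuous-time Markov process $(\eta_t)_{t\ge0}$ on $\mathcal X=\{0,1\}^{[N-1]}$ with generator $\mathcal L=\mathcal L^{\mathrm{bulk}}+\omega_L\mathcal L_L+\omega_R\mathcal L_R$, where for $f:\mathcal X\to\mathbb R$ $$\mathcal L^{\mathrm{bulk}}f(\eta)=\sum_{\{x,y\}\in E}\omega_{x,y}\big\{\eta(x)(1-\eta(y))(f(\eta^{x,y})-f(\eta))+\eta(y)(1-\eta(x))(f(\eta^{y,x})-f(\eta))\big\},$$ $$\mathcal L_Lf(\eta)=\eta(1)(1-\rho_L)(f(\eta^{1,-})-f(\eta))+\rho_L(1-\eta(1))(f(\eta^{1,+})-f(\eta)),$$ $$\mathcal L_Rf(\eta)=\eta(N-1)(1-\rho_R)(f(\eta^{N-1,-})-f(\eta))+\rho_R(1-\eta(N-1))(f(\eta^{N-1,+})-f(\eta)).$$ Here $\eta^{x,y}$ is $\eta$ with a particle moved from $x$ to $y$; $\eta^{x,-}$ (resp. $\eta^{x,+}$) is $\eta$ with the particle at $x$ removed (resp. a particle created at $x$). Dual process: the Markov process $(\xi_t)_{t\ge0}$ on $\hat{\mathcal X}=\mathbb N_0^{\{0\}}\times\{0,1\}^{[N-1]}\times\mathbb N_0^{\{N\}}$ with generator $$\hat{\mathcal L}f(\xi)=\sum_{\{x,y\}\in E}\omega_{x,y}\big\{\xi(x)(1-\xi(y))(f(\xi^{x,y})-f(\xi))+\xi(y)(1-\xi(x))(f(\xi^{y,x})-f(\xi))\big\}$$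 $$+\ \omega_L\,\xi(1)(f(\xi^{1,0})-f(\xi))+\omega_R\,\xi(N-1)(f(\xi^{N-1,N})-f(\xi)),$$ where $\xi^{x,y}$ is $\xi$ with one particle moved from $x$ to $y$; i.e. the exclusion process in the bulk with absorbing sites $0$ and $N$. For $J\subset[N-1]$, $\hat{\mathbb P}_J$ is the law of $(\xi_t)_{t\ge0}$ started from $\xi_0(x)=\mathbf 1_{\{x\in J\}}$. Since $G$ is connected all particles are eventually absorbed almost surely, and $\xi_\infty:=\lim_{t\to\infty}\xi_t$; $\xi_\infty(N)$ is the number of particles absorbed at $N$. In the product measure, the coordinate $\eta(x)$ is Bernoulli$(\rho_R)$ for $x\in I$ and Bernoulli$(\rho_L)$ for $x\notin I$, independently. *)

theory Defs
  imports "HOL-Probability.Probability"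
begin

section \<open>Continuous-time Markov processes on a countable state space\<close>

text \<open>
  A Markov semigroup on the state space \<open>S\<close>, given by its transition kernels \<open>P t x\<close>, with
  generator \<open>L\<close>: \<open>L f\<close> is the right derivative at time 0 of \<open>P\<^sub>t f\<close>, for every bounded \<open>f\<close>.
  (The generators below have bounded jump rates, so bounded functions are the natural domain.)
\<close>

definition markov_semigroup ::
  "'s set \<Rightarrow> (('s \<Rightarrow> real) \<Rightarrow> 's \<Rightarrow> real) \<Rightarrow> (real \<Rightarrow> 's \<Rightarrow> 's pmf) \<Rightarrow> bool" where
  "markov_semigroup S L P \<longleftrightarrow>
     (\<forall>t\<ge>0. \<forall>x\<in>S. set_pmf (P t x) \<subseteq> S) \<and>
     (\<forall>x\<in>S. P 0 x = return_pmf x) \<and>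
     (\<forall>s\<ge>0. \<forall>t\<ge>0. \<forall>x\<in>S. P (s + t) x = bind_pmf (P s x) (P t)) \<and>
     (\<forall>f. bounded (f ` S) \<longrightarrow>
        (\<forall>x\<in>S. ((\<lambda>t. (measure_pmf.expectation (P t x) f - f x) / t) \<longlongrightarrow> L f x) (at_right 0)))"

definition stationary_distribution ::
  "'s set \<Rightarrow> (('s \<Rightarrow> real) \<Rightarrow> 's \<Rightarrow> real) \<Rightarrow> 's pmf \<Rightarrow> bool" where
  "stationary_distribution S L \<mu> \<longleftrightarrow>
     set_pmf \<mu> \<subseteq> S \<and>
     (\<exists>P. markov_semigroup S L P \<and> (\<forall>t\<ge>0. bind_pmf \<mu> (P t) = \<mu>))"

text \<open>The sigma-algebra generated by the process up to time \<open>s\<close>.\<close>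

definition past :: "'w measure \<Rightarrow> 's set \<Rightarrow> (real \<Rightarrow> 'w \<Rightarrow> 's) \<Rightarrow> real \<Rightarrow> 'w measure" where
  "past M S X s =
     sigma (space M) (\<Union>r\<in>{0..s}. {X r -` A \<inter> space M | A. A \<subseteq> S})"

text \<open>
  \<open>X\<close> is a Markov process on the probability space \<open>M\<close> with state space \<open>S\<close> and generator \<open>L\<close>.
  The path condition is right continuity for the discrete topology on \<open>S\<close>. Only times \<open>t \<ge> 0\<close>
  are relevant.
\<close>

definition markov_process ::
  "'s set \<Rightarrow> (('s \<Rightarrow> real) \<Rightarrow> 's \<Rightarrow> real) \<Rightarrow> 'w measure \<Rightarrow> (real \<Rightarrow> 'w \<Rightarrow> 's) \<Rightarrow> bool" where
  "markov_process S L M X \<longleftrightarrow>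
     prob_space M \<and>
     (\<forall>t\<ge>0. X t \<in> measurable M (count_space S)) \<and>
     (\<forall>\<omega>\<in>space M. \<forall>t\<ge>0. \<forall>\<^sub>F s in at_right t. X s \<omega> = X t \<omega>) \<and>
     (\<exists>P. markov_semigroup S L P \<and>
        (\<forall>s\<ge>0. \<forall>t\<ge>0. \<forall>f. bounded (f ` S) \<longrightarrow>
           (AE \<omega> in M. real_cond_exp M (past M S X s) (\<lambda>\<omega>'. f (X (s + t) \<omega>')) \<omega>
                        = measure_pmf.expectation (P t (X s \<omega>)) f)))"

definition limit_state :: "(real \<Rightarrow> 'w \<Rightarrow> 'a \<Rightarrow> nat) \<Rightarrow> 'w \<Rightarrow> 'a \<Rightarrow> nat" where
  "limit_state X \<omega> = (\<lambda>x. Lim at_top (\<lambda>t. X t \<omega> x))"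

section \<open>Boundary driven exclusion and its dual\<close>

text \<open>
  Edges are unordered pairs, represented as two-element sets; \<open>w x y\<close> only matters when
  \<open>{x, y} \<in> E\<close>.
\<close>

definition conductance_graph :: "nat set \<Rightarrow> nat set set \<Rightarrow> (nat \<Rightarrow> nat \<Rightarrow> real) \<Rightarrow> bool" where
  "conductance_graph V E w \<longleftrightarrow>
     finite V \<and>
     (\<forall>e\<in>E. e \<subseteq> V \<and> card e = 2) \<and>
     (\<forall>x\<in>V. \<forall>y\<in>V. (x, y) \<in> {(a, b). {a, b} \<in> E}\<^sup>*) \<and>
     (\<forall>x y. {x, y} \<in> E \<longrightarrow> w x y > 0 \<and> w x y = w y x)"

text \<open>
  Configurations are occupation numbers, extended by 0 outside the sites of the model.
\<close>

definition sep_configs :: "nat \<Rightarrow> (nat \<Rightarrow> nat) set" where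
  "sep_configs N = PiE_dflt {1..N - 1} 0 (\<lambda>_. {0, 1})"

definition dual_configs :: "nat \<Rightarrow> (nat \<Rightarrow> nat) set" where
  "dual_configs N = PiE_dflt {0..N} 0 (\<lambda>x. if x \<in> {1..N - 1} then {0, 1} else UNIV)"

definition move :: "(nat \<Rightarrow> nat) \<Rightarrow> nat \<Rightarrow> nat \<Rightarrow> nat \<Rightarrow> nat" where
  "move \<eta> x y = \<eta>(x := \<eta> x - 1, y := \<eta> y + 1)"

text \<open>The condition \<open>x < y\<close> makes the sum run over each unordered edge exactly once.\<close>

definition bulk_generator ::
  "nat set set \<Rightarrow> (nat \<Rightarrow> nat \<Rightarrow> real) \<Rightarrow> ((nat \<Rightarrow> nat) \<Rightarrow> real) \<Rightarrow> (nat \<Rightarrow> nat) \<Rightarrow> real" where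
  "bulk_generator E w f \<eta> =
     (\<Sum>(x, y) \<in> {(x, y). x < y \<and> {x, y} \<in> E}.
        w x y * (real (\<eta> x) * (1 - real (\<eta> y)) * (f (move \<eta> x y) - f \<eta>)
               + real (\<eta> y) * (1 - real (\<eta> x)) * (f (move \<eta> y x) - f \<eta>)))"

definition reservoir_generator ::
  "real \<Rightarrow> nat \<Rightarrow> ((nat \<Rightarrow> nat) \<Rightarrow> real) \<Rightarrow> (nat \<Rightarrow> nat) \<Rightarrow> real" where
  "reservoir_generator \<rho> x f \<eta> =
     real (\<eta> x) * (1 - \<rho>) * (f (\<eta>(x := 0)) - f \<eta>)
     + \<rho> * (1 - real (\<eta> x)) * (f (\<eta>(x := 1)) - f \<eta>)"

definition sep_generator ::
  "nat \<Rightarrow> nat set set \<Rightarrow> (nat \<Rightarrow> nat \<Rightarrow> real) \<Rightarrow> real \<Rightarrow> real \<Rightarrow> real \<Rightarrow> real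
     \<Rightarrow> ((nat \<Rightarrow> nat) \<Rightarrow> real) \<Rightarrow> (nat \<Rightarrow> nat) \<Rightarrow> real" where
  "sep_generator N E w \<omega>L \<omega>R \<rho>L \<rho>R f \<eta> =
     bulk_generator E w f \<eta>
     + \<omega>L * reservoir_generator \<rho>L 1 f \<eta>
     + \<omega>R * reservoir_generator \<rho>R (N - 1) f \<eta>"

definition dual_generator ::
  "nat \<Rightarrow> nat set set \<Rightarrow> (nat \<Rightarrow> nat \<Rightarrow> real) \<Rightarrow> real \<Rightarrow> real
     \<Rightarrow> ((nat \<Rightarrow> nat) \<Rightarrow> real) \<Rightarrow> (nat \<Rightarrow> nat) \<Rightarrow> real" where
  "dual_generator N E w \<omega>L \<omega>R f \<xi> =
     bulk_generator E w f \<xi>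
     + \<omega>L * real (\<xi> 1) * (f (move \<xi> 1 0) - f \<xi>)
     + \<omega>R * real (\<xi> (N - 1)) * (f (move \<xi> (N - 1) N) - f \<xi>)"

definition bernoulli_product :: "nat \<Rightarrow> real \<Rightarrow> real \<Rightarrow> nat set \<Rightarrow> (nat \<Rightarrow> nat) pmf" where
  "bernoulli_product N \<rho>L \<rho>R I =
     Pi_pmf {1..N - 1} 0
       (\<lambda>x. map_pmf of_bool (bernoulli_pmf (if x \<in> I then \<rho>R else \<rho>L)))"

text \<open>
  The weight \<open>F(I)\<close>. The dual process started from the indicator of \<open>J\<close> is \<open>\<Xi> J\<close>, realised on the
  probability space \<open>M J\<close>.
\<close>

definition mixture_weight ::
  "nat \<Rightarrow> (nat set \<Rightarrow> 'w measure) \<Rightarrow> (nat set \<Rightarrow> real \<Rightarrow> 'w \<Rightarrow> nat \<Rightarrow> nat) \<Rightarrow> nat set \<Rightarrow> real" where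
  "mixture_weight N M \<Xi> I =
     (\<Sum>J \<in> {J \<in> Pow {1..N - 1}. I \<subseteq> J}.
        (-1) ^ card (J - I) *
        measure (M J) {\<omega> \<in> space (M J). limit_state (\<Xi> J) \<omega> N = card J})"

end

theory Submission
  imports Defs
begin

text \<open>
  Compare two exclusion processes on the same graph: the one with densities \<open>\<rho>L\<close>, \<open>\<rho>R\<close>,
  and the extreme one with densities 0 and 1, whose left reservoir only removes and whose right
  reservoir only inserts particles. A configuration of the extreme process is a set \<open>I\<close> of sites.
  Colour it by putting independent Bernoulli variables on the sites, with parameter \<open>\<rho>R\<close> on
  \<open>I\<close> and \<open>\<rho>L\<close> off \<open>I\<close>. On occupation numbers 0 and 1, a bulk move along an edge just
  exchanges the contents of its two ends, and this commutes with colouring. A reservoir replaces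
  the content of its site by a fresh Bernoulli variable, and a site that the extreme process has
  just emptied (filled) is coloured with exactly the law that the left (right) reservoir would
  have put there. So averaging over colourings intertwines the two generators
  (\<open>set_generator_intertwining\<close>), and the colouring of an invariant measure of the extreme process
  is invariant for the original one (\<open>product_mixture_invariant\<close>).

  It remains to see that \<open>F\<close> is an invariant probability measure of the extreme process. By
  Moebius inversion the sum of \<open>F\<close> over the supersets of \<open>J\<close> is the probability \<open>h J\<close> that all
  dual particles started from \<open>J\<close> end at \<open>N\<close>. Applied to the function \<open>J \<subseteq> I\<close>, the
  extreme generator acts in the variable \<open>J\<close> as the generator of the dual process killed at the
  left end (\<open>set_generator_containment\<close>), and \<open>h\<close> is harmonic for that operator
  (\<open>absorption_probabilities_killed_harmonic\<close>). As containment functions span all functions of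
  \<open>I\<close>, the measure \<open>F\<close> is invariant (\<open>mobius_transform_invariant\<close>), with total mass \<open>h {} = 1\<close>.

  Positivity of \<open>F\<close> and uniqueness of the stationary distribution are one fact about signed
  invariant measures. The set of configurations where such a measure is positive is closed under
  all transitions (\<open>invariant_signed_measure_positive\<close>). A nonempty closed family is everything
  (\<open>closed_family_full\<close>): on a connected graph all particles can be led to a given site and
  removed there, and exchanges are reversible. Hence a signed invariant measure of total mass 1 is
  strictly positive, and one of total mass 0, such as the difference of two stationary
  distributions, vanishes.

  The analytic input has three parts. A finite set on whose indicator the generator vanishes at
  all its points is never left (\<open>markov_semigroup_finite_closed\<close>); this makes the number of dual
  particles constant and the number of particles at \<open>N\<close> nondecreasing, so the limit along almost
  every path exists and its law is a limit of transition probabilities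
  (\<open>markov_process_limit_probability\<close>). Such limits are harmonic (\<open>markov_semigroup_absorption\<close>).
  The processes for different \<open>J\<close> may come with different semigroups, and a maximum principle
  (\<open>killed_harmonic_unique\<close>) shows that they nevertheless give values of one and the same harmonic
  function. Finally, a semigroup for the exclusion generator is built by running a discrete chain
  at the times of a Poisson process (\<open>jump_generator_stationary\<close>).
\<close>

section \<open>Alternating sums over subsets\<close>

text \<open>
  Toggling one element of \<open>D\<close> pairs subsets of opposite sign.
\<close>

lemma sum_alternating_Pow:
  assumes "finite D"
  shows "(\<Sum>S\<in>Pow D. (-1) ^ card S :: real) = of_bool (D = {})"
  using assms
proof (induction D)
  case empty
  then show ?case by simp
next
  case (insert x D)
  have "(\<Sum>S\<in>insert x ` Pow D. (-1) ^ card S :: real) = (\<Sum>S\<in>Pow D. (-1) ^ card (insert x S))"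
    using insert.hyps by (subst sum.reindex) (auto simp: inj_on_def)
  also have "\<dots> = (\<Sum>S\<in>Pow D. - ((-1) ^ card S))"
    using insert.hyps finite_subset
    by (intro sum.cong refl) (subst card_insert_disjoint; force)
  finally show ?case
    using insert.hyps by (subst Pow_insert, subst sum.union_disjoint) (auto simp: sum_negf)
qed

lemma sum_alternating_above:
  assumes "finite L" "K \<subseteq> L"
  shows "(\<Sum>J | K \<subseteq> J \<and> J \<subseteq> L. (-1) ^ card (J - K) :: real) = of_bool (K = L)"
proof -
  have "(\<Sum>J | K \<subseteq> J \<and> J \<subseteq> L. (-1) ^ card (J - K) :: real) = (\<Sum>S\<in>Pow (L - K). (-1) ^ card S)"
    using assms(2) by (intro sum.reindex_bij_witness[of _ "\<lambda>S. S \<union> K" "\<lambda>J. J - K"]) (auto intro!: arg_cong[where f=card])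
  then show ?thesis
    using assms by (auto simp: sum_alternating_Pow)
qed

lemma sum_alternating_below:
  assumes "finite L" "K \<subseteq> L"
  shows "(\<Sum>J | K \<subseteq> J \<and> J \<subseteq> L. (-1) ^ card (L - J) :: real) = of_bool (K = L)"
proof -
  have "(\<Sum>J | K \<subseteq> J \<and> J \<subseteq> L. (-1) ^ card (L - J) :: real) = (\<Sum>S\<in>Pow (L - K). (-1) ^ card S)"
    using assms(2) by (intro sum.reindex_bij_witness[of _ "\<lambda>S. L - S" "\<lambda>J. L - J"]) (auto intro!: arg_cong[where f=card])
  then show ?thesis
    using assms by (auto simp: sum_alternating_Pow)
qed

text \<open>
  Moebius inversion on the lattice of subsets, in the direction in which the weights of the
  theorem are defined: summing the weights over supersets recovers the absorption probability.
\<close>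

lemma sum_superset_mobius:
  fixes h :: "'a set \<Rightarrow> real"
  assumes "finite V" "J \<subseteq> V"
  shows "(\<Sum>I | J \<subseteq> I \<and> I \<subseteq> V. \<Sum>K | K \<subseteq> V \<and> I \<subseteq> K. (-1) ^ card (K - I) * h K) = h J"
proof -
  have fin: "finite {K. K \<subseteq> V}" "finite {I. J \<subseteq> I \<and> I \<subseteq> V}"
    using assms(1) by (auto intro: finite_subset[of _ "Pow V"])
  have "(\<Sum>I | J \<subseteq> I \<and> I \<subseteq> V. \<Sum>K | K \<subseteq> V \<and> I \<subseteq> K. (-1) ^ card (K - I) * h K)
      = (\<Sum>K | K \<subseteq> V. \<Sum>I | I \<in> {I. J \<subseteq> I \<and> I \<subseteq> V} \<and> I \<subseteq> K. (-1) ^ card (K - I) * h K)"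
    using sum.swap_restrict[OF fin(2,1), of "\<lambda>I K. (-1) ^ card (K - I) * h K" "\<lambda>I K. I \<subseteq> K"]
    by (simp add: conj_commute)
  also have "\<dots> = (\<Sum>K | K \<subseteq> V. if K = J then h J else 0)"
  proof (intro sum.cong refl)
    fix K assume K: "K \<in> {K. K \<subseteq> V}"
    then have eq: "{I. I \<in> {I. J \<subseteq> I \<and> I \<subseteq> V} \<and> I \<subseteq> K} = {I. J \<subseteq> I \<and> I \<subseteq> K}" by auto
    show "(\<Sum>I | I \<in> {I. J \<subseteq> I \<and> I \<subseteq> V} \<and> I \<subseteq> K. (-1) ^ card (K - I) * h K)
        = (if K = J then h J else 0)"
    proof (cases "J \<subseteq> K")
      case True
      have "finite K" using K finite_subset[OF _ assms(1)] by blast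
      then show ?thesis
        unfolding eq using sum_alternating_below[OF _ True] by (simp flip: sum_distrib_right)
    next
      case False
      then have e: "{I. J \<subseteq> I \<and> I \<subseteq> K} = {}" and "K \<noteq> J" by auto
      then show ?thesis unfolding eq e by simp
    qed
  qed
  also have "\<dots> = h J" using fin assms(2) by simp
  finally show ?thesis .
qed

text \<open>
  The functions \<open>\<lambda>I. of_bool (J \<subseteq> I)\<close> span all functions on the subsets of \<open>V\<close>;
  the coefficients are the alternating sums over the subsets of \<open>J\<close>.
\<close>

lemma mobius_expansion:
  fixes g :: "'a set \<Rightarrow> real"
  assumes "finite V" "I \<subseteq> V"
  shows "g I = (\<Sum>J\<in>Pow V. (\<Sum>K | K \<subseteq> J. (-1) ^ card (J - K) * g K) * of_bool (J \<subseteq> I))"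
proof -
  have fin: "finite {K. K \<subseteq> V}" "finite {K. K \<subseteq> I}" "finite I"
    using assms by (auto intro: finite_subset[of _ "Pow V"] finite_subset)
  have "(\<Sum>J\<in>Pow V. (\<Sum>K | K \<subseteq> J. (-1) ^ card (J - K) * g K) * of_bool (J \<subseteq> I))
     = (\<Sum>J | J \<subseteq> I. \<Sum>K | K \<in> {K. K \<subseteq> I} \<and> K \<subseteq> J. (-1) ^ card (J - K) * g K)"
  proof (rule sum.mono_neutral_cong_right)
    show "finite (Pow V)" "{J. J \<subseteq> I} \<subseteq> Pow V" using assms by auto
    show "\<forall>J\<in>Pow V - {J. J \<subseteq> I}. (\<Sum>K | K \<subseteq> J. (-1) ^ card (J - K) * g K) * of_bool (J \<subseteq> I) = 0"
      by auto
    show "(\<Sum>K | K \<subseteq> J. (-1) ^ card (J - K) * g K) * of_bool (J \<subseteq> I)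
      = (\<Sum>K | K \<in> {K. K \<subseteq> I} \<and> K \<subseteq> J. (-1) ^ card (J - K) * g K)" if "J \<in> {J. J \<subseteq> I}" for J
    proof -
      have "{K. K \<subseteq> J} = {K. K \<in> {K. K \<subseteq> I} \<and> K \<subseteq> J}" using that assms by auto
      then show ?thesis using that by simp
    qed
  qed
  also have "\<dots> = (\<Sum>K | K \<subseteq> I. \<Sum>J | J \<in> {J. J \<subseteq> I} \<and> K \<subseteq> J. (-1) ^ card (J - K) * g K)"
    by (rule sum.swap_restrict[OF fin(2,2)])
  also have "\<dots> = (\<Sum>K | K \<subseteq> I. if K = I then g I else 0)"
  proof (intro sum.cong refl)
    fix K assume "K \<in> {K. K \<subseteq> I}"
    then show "(\<Sum>J | J \<in> {J. J \<subseteq> I} \<and> K \<subseteq> J. (-1) ^ card (J - K) * g K) = (if K = I then g I else 0)"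
      using sum_alternating_above[of I K] fin
      by (auto simp: conj_commute simp flip: sum_distrib_right)
  qed
  also have "\<dots> = g I" using fin by simp
  finally show ?thesis by simp
qed

section \<open>Consequences of the generator equation for a Markov semigroup\<close>

lemma markov_semigroupD:
  assumes "markov_semigroup S L P"
  shows "\<And>t x. 0 \<le> t \<Longrightarrow> x \<in> S \<Longrightarrow> set_pmf (P t x) \<subseteq> S"
    and "\<And>x. x \<in> S \<Longrightarrow> P 0 x = return_pmf x"
    and "\<And>s t x. 0 \<le> s \<Longrightarrow> 0 \<le> t \<Longrightarrow> x \<in> S \<Longrightarrow> P (s + t) x = bind_pmf (P s x) (P t)"
    and "\<And>f x. bounded (f ` S) \<Longrightarrow> x \<in> S \<Longrightarrow>
      ((\<lambda>t. (measure_pmf.expectation (P t x) f - f x) / t) \<longlongrightarrow> L f x) (at_right 0)"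
  using assms unfolding markov_semigroup_def by blast+

lemma prob_bind_pmf:
  "measure_pmf.prob (bind_pmf p f) A = measure_pmf.expectation p (\<lambda>x. measure_pmf.prob (f x) A)"
proof -
  have "ennreal (measure_pmf.prob (bind_pmf p f) A)
      = (\<integral>\<^sup>+ x. ennreal (measure_pmf.prob (f x) A) \<partial>measure_pmf p)"
    by (simp flip: measure_pmf.emeasure_eq_measure)
  also have "\<dots> = ennreal (measure_pmf.expectation p (\<lambda>x. measure_pmf.prob (f x) A))"
    by (intro nn_integral_eq_integral measure_pmf.integrable_const_bound[where B=1]) auto
  finally show ?thesis by (simp add: integral_nonneg)
qed

lemma integrable_pmf_bounded:
  fixes f :: "'a \<Rightarrow> real"
  assumes "\<And>x. x \<in> set_pmf p \<Longrightarrow> \<bar>f x\<bar> \<le> B"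
  shows "integrable (measure_pmf p) f"
  using assms by (intro measure_pmf.integrable_const_bound[where B=B]) (auto simp: AE_measure_pmf_iff)

text \<open>
  The generator only controls the semigroup near time 0 and pointwise, so this is where finiteness
  of \<open>C\<close> enters: the probability of leaving \<open>C\<close> within a short time \<open>s\<close> is at most
  \<open>\<epsilon> * s\<close>, uniformly in the starting point. Cutting \<open>[0, t]\<close> into many steps of equal
  length bounds the probability of being outside \<open>C\<close> at time \<open>t\<close> by \<open>\<epsilon> * t\<close>.
\<close>

lemma markov_semigroup_finite_closed:
  assumes sg: "markov_semigroup S L P"
    and C: "finite C" "C \<subseteq> S" and L0: "\<And>x. x \<in> C \<Longrightarrow> L (indicator C) x = 0"
    and t: "t \<ge> 0" and x: "x \<in> C"
  shows "measure_pmf.prob (P t x) C = 1"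
proof (cases "t = 0")
  case True
  then show ?thesis using x C markov_semigroupD(2)[OF sg, of x] by auto
next
  case False
  with t have t: "t > 0" by simp
  let ?p = "\<lambda>s x. measure_pmf.prob (P s x) C"
  have iterate: "1 - real n * \<delta> \<le> ?p (real n * s) x"
    if s: "s \<ge> 0" and \<delta>: "\<delta> \<ge> 0" "\<And>y. y \<in> C \<Longrightarrow> 1 - \<delta> \<le> ?p s y" and x: "x \<in> C" for n s \<delta> x
  proof (induction n)
    case 0
    then show ?case using x C markov_semigroupD(2)[OF sg, of x] by auto
  next
    case (Suc n)
    have "(1 - \<delta>) * ?p (real n * s) x
        = measure_pmf.expectation (P (real n * s) x) (\<lambda>y. (1 - \<delta>) * indicator C y)"
      by simp
    also have "\<dots> \<le> measure_pmf.expectation (P (real n * s) x) (\<lambda>y. ?p s y)"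
      using \<delta> by (intro integral_mono integrable_pmf_bounded[where B="1 + \<bar>\<delta>\<bar>"]
          integrable_pmf_bounded[where B=1])
        (auto simp: indicator_def)
    also have "\<dots> = ?p (real (Suc n) * s) x"
      using markov_semigroupD(3)[OF sg, of "real n * s" s x] x s C(2)
      by (auto simp: prob_bind_pmf algebra_simps)
    finally have "(1 - \<delta>) * ?p (real n * s) x \<le> ?p (real (Suc n) * s) x" .
    moreover have "\<delta> * ?p (real n * s) x \<le> \<delta> * 1" using \<delta>(1) by (intro mult_left_mono) auto
    ultimately show ?case using Suc by (simp add: algebra_simps)
  qed
  have "1 - \<epsilon> * t \<le> ?p t x" if "\<epsilon> > 0" for \<epsilon>
  proof -
    have "\<forall>\<^sub>F s in at_right 0. 1 - \<epsilon> * s \<le> ?p s y" if y: "y \<in> C" for y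
    proof -
      have "((\<lambda>s. (measure_pmf.expectation (P s y) (indicator C) - indicator C y) / s)
          \<longlongrightarrow> L (indicator C) y) (at_right 0)"
        using y C by (intro markov_semigroupD(4)[OF sg]) (auto simp: indicator_def bounded_iff)
      then have "((\<lambda>s. (?p s y - 1) / s) \<longlongrightarrow> 0) (at_right 0)"
        using L0[OF y] y by simp
      then have "\<forall>\<^sub>F s in at_right 0. (?p s y - 1) / s > - \<epsilon>"
        using order_tendstoD(1)[of _ 0 _ "- \<epsilon>"] \<open>\<epsilon> > 0\<close> by simp
      then show ?thesis
        using eventually_at_right_less[of 0] by eventually_elim (simp add: field_simps)
    qed
    then have ev: "\<forall>\<^sub>F s in at_right 0. \<forall>y\<in>C. 1 - \<epsilon> * s \<le> ?p s y"
      by (intro eventually_ball_finite C) blast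
    have "(\<lambda>n. t / real (Suc n)) \<longlonglongrightarrow> 0"
      using tendsto_mult_right_zero[OF LIMSEQ_inverse_real_of_nat, of t] by (simp add: field_simps)
    then have "filterlim (\<lambda>n. t / real (Suc n)) (at_right 0) sequentially"
      unfolding filterlim_at using t by (intro conjI always_eventually allI) simp_all
    then have "\<forall>\<^sub>F n in sequentially. \<forall>y\<in>C. 1 - \<epsilon> * (t / real (Suc n)) \<le> ?p (t / real (Suc n)) y"
      using ev unfolding filterlim_iff by blast
    then obtain n where n: "\<forall>y\<in>C. 1 - \<epsilon> * (t / real (Suc n)) \<le> ?p (t / real (Suc n)) y"
      by (auto simp: eventually_sequentially)
    show ?thesis
      using iterate[of "t / real (Suc n)" "\<epsilon> * (t / real (Suc n))" x "Suc n"] n t x \<open>\<epsilon> > 0\<close> by simp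
  qed
  note bound = this
  have "1 \<le> ?p t x"
  proof (rule field_le_epsilon)
    fix e :: real assume "e > 0"
    then show "1 \<le> ?p t x + e" using bound[of "e / t"] t by simp
  qed
  then show ?thesis using measure_pmf.prob_le_1[of "P t x" C] by linarith
qed

text \<open>
  Since \<open>D\<close> is never left, \<open>P t x D\<close> is nondecreasing in \<open>t\<close>, and its limit \<open>v\<close> is invariant under
  the semigroup by the Chapman-Kolmogorov equation; the difference quotient that defines \<open>L v\<close> is
  therefore 0. The last conclusion gives the zero boundary values of \<open>v\<close>: from a closed set that
  misses \<open>D\<close> the process never gets absorbed.
\<close>

lemma markov_semigroup_absorption:
  assumes sg: "markov_semigroup S L P"
    and C: "finite C" "C \<subseteq> S" and LC: "\<And>x. x \<in> C \<Longrightarrow> L (indicator C) x = 0"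
    and D: "D \<subseteq> C" and LD: "\<And>x. x \<in> D \<Longrightarrow> L (indicator D) x = 0"
  obtains v where
    "\<And>x. x \<in> C \<Longrightarrow> (\<lambda>n. measure_pmf.prob (P (real n) x) D) \<longlonglongrightarrow> v x"
    "\<And>x. x \<in> C \<Longrightarrow> L v x = 0"
    "\<And>x. x \<in> D \<Longrightarrow> v x = 1"
    "\<And>x B. x \<in> B \<Longrightarrow> B \<subseteq> C \<Longrightarrow> B \<inter> D = {} \<Longrightarrow> (\<And>x. x \<in> B \<Longrightarrow> L (indicator B) x = 0) \<Longrightarrow> v x = 0"
proof -
  let ?p = "\<lambda>s x. measure_pmf.prob (P s x) D"
  have stay: "measure_pmf.prob (P t x) B = 1"
    if "B \<subseteq> C" "\<And>x. x \<in> B \<Longrightarrow> L (indicator B) x = 0" "t \<ge> 0" "x \<in> B" for B t x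
    using that C finite_subset[of B C] by (intro markov_semigroup_finite_closed[OF sg]) auto
  have supp: "set_pmf (P t x) \<subseteq> C" if "x \<in> C" "t \<ge> 0" for x t
  proof -
    have "measure_pmf.prob (P t x) C = 1"
      using LC that by (intro stay) auto
    then have "AE y in measure_pmf (P t x). y \<in> C"
      by (simp add: measure_pmf.prob_eq_1)
    then show ?thesis by (auto simp: AE_measure_pmf_iff)
  qed
  have mono: "?p s x \<le> ?p t x" if "x \<in> C" "0 \<le> s" "s \<le> t" for x s t
  proof -
    have "?p s x = measure_pmf.expectation (P s x) (indicator D)" by simp
    also have "\<dots> \<le> measure_pmf.expectation (P s x) (\<lambda>y. ?p (t - s) y)"
      using that stay[OF D LD, of "t - s"]
      by (intro integral_mono integrable_pmf_bounded[where B=1]) (auto simp: indicator_def)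
    also have "\<dots> = ?p t x"
      using markov_semigroupD(3)[OF sg, of s "t - s" x] that C(2) by (auto simp: prob_bind_pmf)
    finally show ?thesis .
  qed
  define v where "v x = (if x \<in> C then lim (\<lambda>n. ?p (real n) x) else 0)" for x
  have lim: "(\<lambda>n. ?p (real n) x) \<longlonglongrightarrow> v x" if "x \<in> C" for x
  proof -
    have "incseq (\<lambda>n. ?p (real n) x)" using mono[OF that] by (intro incseq_SucI) simp
    moreover have "?p (real n) x \<le> 1" for n by simp
    ultimately have "convergent (\<lambda>n. ?p (real n) x)"
      using incseq_convergent[of "\<lambda>n. ?p (real n) x" 1] by (metis convergent_def)
    then show ?thesis using that by (simp add: v_def convergent_LIMSEQ_iff)
  qed
  have invariant: "measure_pmf.expectation (P s x) v = v x" if x: "x \<in> C" and s: "s \<ge> 0" for x s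
  proof -
    have "(\<lambda>n. \<Sum>y\<in>C. ?p (real n) y * pmf (P s x) y) \<longlonglongrightarrow> (\<Sum>y\<in>C. v y * pmf (P s x) y)"
      by (intro tendsto_sum tendsto_mult tendsto_const lim)
    moreover have "(\<Sum>y\<in>C. f y * pmf (P s x) y) = measure_pmf.expectation (P s x) f" for f
      using supp[OF x s] C(1) by (subst integral_measure_pmf_real[of C]) auto
    moreover have "measure_pmf.expectation (P s x) (\<lambda>y. ?p (real n) y) = ?p (s + real n) x" for n
      using markov_semigroupD(3)[OF sg, of s "real n" x] x s C(2) by (auto simp: prob_bind_pmf)
    ultimately have "(\<lambda>n. ?p (s + real n) x) \<longlonglongrightarrow> measure_pmf.expectation (P s x) v" by simp
    moreover have "(\<lambda>n. ?p (s + real n) x) \<longlonglongrightarrow> v x"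
    proof (rule tendsto_sandwich)
      show "(\<lambda>n. ?p (real n) x) \<longlonglongrightarrow> v x" by (rule lim[OF x])
      \<comment> \<open>by monotonicity, \<open>s + n\<close> may be rounded up to an integer time\<close>
      show "(\<lambda>n. ?p (real (n + nat \<lceil>s\<rceil>)) x) \<longlonglongrightarrow> v x"
        using LIMSEQ_ignore_initial_segment[OF lim[OF x]] .
      show "\<forall>\<^sub>F n in sequentially. ?p (real n) x \<le> ?p (s + real n) x"
        using mono[OF x] s by simp
      show "\<forall>\<^sub>F n in sequentially. ?p (s + real n) x \<le> ?p (real (n + nat \<lceil>s\<rceil>)) x"
        using mono[OF x] s by (intro always_eventually allI mono[OF x]) (auto simp: of_nat_ceiling)
    qed
    ultimately show ?thesis by (rule LIMSEQ_unique)
  qed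
  show thesis
  proof (rule that[of v])
    show "L v x = 0" if x: "x \<in> C" for x
    proof -
      have "v ` S \<subseteq> insert 0 (v ` C)" by (auto simp: v_def)
      then have "bounded (v ` S)"
        using C(1) by (meson finite_imageI finite_imp_bounded finite_insert finite_subset)
      then have "((\<lambda>t. (measure_pmf.expectation (P t x) v - v x) / t) \<longlongrightarrow> L v x) (at_right 0)"
        using x C(2) by (intro markov_semigroupD(4)[OF sg]) auto
      moreover have "\<forall>\<^sub>F t in at_right 0. (measure_pmf.expectation (P t x) v - v x) / t = (0::real)"
        using eventually_at_right_less[of "0::real"] by eventually_elim (simp add: invariant[OF x])
      then have "((\<lambda>t. (measure_pmf.expectation (P t x) v - v x) / t) \<longlongrightarrow> 0) (at_right 0)"
        by (rule tendsto_eventually)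
      ultimately show ?thesis by (intro tendsto_unique[of "at_right (0::real)"]) simp_all
    qed
    show "v x = 1" if "x \<in> D" for x
      using lim[of x] stay[OF D LD _ that] that D LIMSEQ_unique[OF _ tendsto_const] by auto
    show "v x = 0" if "x \<in> B" "B \<subseteq> C" "B \<inter> D = {}" "\<And>x. x \<in> B \<Longrightarrow> L (indicator B) x = 0" for x B
    proof -
      have "?p (real n) x = 0" for n
      proof -
        have "?p (real n) x + measure_pmf.prob (P (real n) x) B = measure_pmf.prob (P (real n) x) (D \<union> B)"
          using that(3) by (subst measure_pmf.finite_measure_Union) auto
        then show ?thesis
          using stay[OF that(2,4) _ that(1), of "real n"] measure_pmf.prob_le_1[of "P (real n) x" "D \<union> B"]
            measure_nonneg[of "P (real n) x" D] by linarith
      qed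
      moreover have "x \<in> C" using that by blast
      ultimately have "(\<lambda>n. 0) \<longlonglongrightarrow> v x" using lim[of x] by simp
      then show ?thesis using LIMSEQ_unique tendsto_const by metis
    qed
  qed (rule lim)
qed

text \<open>
  Differentiate the mean of \<open>f\<close> under the law \<open>\<mu> P\<^sub>t = \<mu>\<close> at time 0; on a finite
  state space the sum may be differentiated term by term.
\<close>

lemma stationary_imp_generator_mean_zero:
  assumes S: "finite S" and st: "stationary_distribution S L \<mu>"
  shows "(\<Sum>x\<in>S. pmf \<mu> x * L f x) = 0"
proof -
  from st obtain P where sub: "set_pmf \<mu> \<subseteq> S" and sg: "markov_semigroup S L P"
    and inv: "\<And>t. t \<ge> 0 \<Longrightarrow> bind_pmf \<mu> (P t) = \<mu>"
    unfolding stationary_distribution_def by blast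
  have fin: "finite (set_pmf (P t x))" if "t \<ge> 0" "x \<in> S" for t x
    using markov_semigroupD(1)[OF sg that] S finite_subset by blast
  let ?D = "\<lambda>t x. (measure_pmf.expectation (P t x) f - f x) / t"
  have mean: "(\<Sum>x\<in>S. pmf \<mu> x * measure_pmf.expectation (P t x) f) = (\<Sum>x\<in>S. pmf \<mu> x * f x)"
    if "t \<ge> 0" for t
  proof -
    have "measure_pmf.expectation (bind_pmf \<mu> (P t)) f
        = (\<Sum>x\<in>S. pmf \<mu> x *\<^sub>R measure_pmf.expectation (P t x) f)"
      using S sub fin[OF that] by (intro pmf_expectation_bind) auto
    moreover have "measure_pmf.expectation \<mu> f = (\<Sum>x\<in>S. f x * pmf \<mu> x)"
      using S sub by (intro integral_measure_pmf_real) auto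
    ultimately show ?thesis using inv[OF that] by (simp add: mult.commute)
  qed
  have "((\<lambda>t. \<Sum>x\<in>S. pmf \<mu> x * ?D t x) \<longlongrightarrow> (\<Sum>x\<in>S. pmf \<mu> x * L f x)) (at_right 0)"
    using S by (intro tendsto_sum tendsto_mult tendsto_const markov_semigroupD(4)[OF sg])
      (auto intro: finite_imp_bounded)
  moreover have "\<forall>\<^sub>F t in at_right 0. (\<Sum>x\<in>S. pmf \<mu> x * ?D t x) = (0::real)"
    using eventually_at_right_less[of "0::real"]
  proof eventually_elim
    case (elim t)
    have "(\<Sum>x\<in>S. pmf \<mu> x * ?D t x)
        = ((\<Sum>x\<in>S. pmf \<mu> x * measure_pmf.expectation (P t x) f) - (\<Sum>x\<in>S. pmf \<mu> x * f x)) / t"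
      by (simp add: right_diff_distrib sum_subtractf flip: sum_divide_distrib)
    then show ?case using mean[of t] elim by simp
  qed
  then have "((\<lambda>t. \<Sum>x\<in>S. pmf \<mu> x * ?D t x) \<longlongrightarrow> 0) (at_right 0)" by (rule tendsto_eventually)
  ultimately show ?thesis by (intro tendsto_unique[of "at_right (0::real)"]) simp_all
qed

section \<open>Limits along the paths of a Markov process\<close>

lemma subalgebra_past:
  assumes X: "\<And>t. t \<ge> 0 \<Longrightarrow> X t \<in> measurable M (count_space S)"
  shows "subalgebra M (past M S X s)"
proof -
  let ?G = "\<Union>r\<in>{0..s}. {X r -` A \<inter> space M | A. A \<subseteq> S}"
  have G: "?G \<subseteq> sets M"
    using measurable_sets[OF X] by auto
  then have "?G \<subseteq> Pow (space M)"
    using sets.sets_into_space by blast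
  then show ?thesis
    unfolding subalgebra_def past_def
    using sets.sigma_sets_subset[OF G] by (simp add: space_measure_of_conv sets_measure_of)
qed

lemma past_event:
  assumes "s \<ge> 0" "A \<subseteq> S"
  shows "X s -` A \<inter> space M \<in> sets (past M S X s)"
proof -
  let ?G = "\<Union>r\<in>{0..s}. {X r -` A \<inter> space M | A. A \<subseteq> S}"
  have "?G \<subseteq> Pow (space M)" by auto
  then have "sets (past M S X s) = sigma_sets (space M) ?G"
    unfolding past_def by (rule sets_measure_of)
  moreover have "X s -` A \<inter> space M \<in> ?G" using assms by (intro UN_I[of s]) auto
  ultimately show ?thesis by (auto intro: sigma_sets.Basic)
qed

text \<open>
  The Markov property integrated against an event at time \<open>s\<close>.
\<close>

lemma markov_process_conditional:
  assumes ps: "prob_space M"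
    and X: "\<And>t. t \<ge> 0 \<Longrightarrow> X t \<in> measurable M (count_space S)"
    and cond: "AE \<omega> in M. real_cond_exp M (past M S X s) (\<lambda>\<omega>'. indicator C (X (s + t) \<omega>')) \<omega>
                        = measure_pmf.prob (P t (X s \<omega>)) C"
    and st: "s \<ge> 0" "t \<ge> 0" and A: "A \<subseteq> S"
  shows "(\<integral>\<omega>. indicator A (X s \<omega>) * indicator C (X (s + t) \<omega>) \<partial>M)
       = (\<integral>\<omega>. indicator A (X s \<omega>) * measure_pmf.prob (P t (X s \<omega>)) C \<partial>M)"
proof -
  interpret prob_space M by fact
  interpret F: finite_measure_subalgebra M "past M S X s"
    by unfold_locales (rule subalgebra_past[OF X])
  have C: "(\<lambda>\<omega>. indicator C (X (s + t) \<omega>) :: real) \<in> borel_measurable M"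
    by (rule measurable_compose[OF X]) (use st in auto)
  have P: "(\<lambda>\<omega>. measure_pmf.prob (P t (X s \<omega>)) C) \<in> borel_measurable M"
    by (rule measurable_compose[OF X]) (use st in auto)
  have A_M: "(\<lambda>\<omega>. indicator A (X s \<omega>) :: real) \<in> borel_measurable M"
    by (rule measurable_compose[OF X]) (use st in auto)
  have eq: "indicator A (X s \<omega>) = (indicator (X s -` A \<inter> space M) \<omega> :: real)" if "\<omega> \<in> space M" for \<omega>
    using that by (simp add: indicator_def)
  have sp: "space (past M S X s) = space M" using F.subalg by (simp add: subalgebra_def)
  have A_F: "(\<lambda>\<omega>. indicator A (X s \<omega>) :: real) \<in> borel_measurable (past M S X s)"
    by (subst measurable_cong[OF eq]) (use past_event[OF st(1) A, of X M] in \<open>auto simp: sp\<close>)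
  have int: "integrable M (\<lambda>\<omega>. indicator A (X s \<omega>) * indicator C (X (s + t) \<omega>) :: real)"
    using A_M C by (intro integrable_const_bound[where B=1]) (auto simp: indicator_def)
  have "(\<integral>\<omega>. indicator A (X s \<omega>) * indicator C (X (s + t) \<omega>) \<partial>M)
      = (\<integral>\<omega>. indicator A (X s \<omega>) *
          real_cond_exp M (past M S X s) (\<lambda>\<omega>'. indicator C (X (s + t) \<omega>')) \<omega> \<partial>M)"
    by (rule F.real_cond_exp_intg(2)[OF int A_F C, symmetric])
  also have "\<dots> = (\<integral>\<omega>. indicator A (X s \<omega>) * measure_pmf.prob (P t (X s \<omega>)) C \<partial>M)"
    using cond A_M P by (intro integral_cong_AE) auto
  finally show ?thesis .
qed

lemma markov_process_stays:
  assumes ps: "prob_space M"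
    and X: "\<And>t. t \<ge> 0 \<Longrightarrow> X t \<in> measurable M (count_space S)"
    and cond: "AE \<omega> in M. real_cond_exp M (past M S X s) (\<lambda>\<omega>'. indicator C (X (s + t) \<omega>')) \<omega>
                        = measure_pmf.prob (P t (X s \<omega>)) C"
    and st: "s \<ge> 0" "t \<ge> 0" and C: "C \<subseteq> S" and stay: "\<And>x. x \<in> C \<Longrightarrow> measure_pmf.prob (P t x) C = 1"
  shows "AE \<omega> in M. X s \<omega> \<in> C \<longrightarrow> X (s + t) \<omega> \<in> C"
proof -
  interpret prob_space M by fact
  have meas: "(\<lambda>\<omega>. indicator C (X r \<omega>) :: real) \<in> borel_measurable M" if "r \<ge> 0" for r
    by (rule measurable_compose[OF X]) (use that in auto)
  let ?g = "\<lambda>\<omega>. indicator C (X s \<omega>) - indicator C (X s \<omega>) * indicator C (X (s + t) \<omega>) :: real"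
  have int: "integrable M (\<lambda>\<omega>. indicator C (X s \<omega>) :: real)"
      "integrable M (\<lambda>\<omega>. indicator C (X s \<omega>) * indicator C (X (s + t) \<omega>) :: real)"
    using meas[of s] meas[of "s + t"] st
    by (auto intro!: integrable_const_bound[where B=1] simp: indicator_def)
  have "(\<integral>\<omega>. indicator C (X s \<omega>) * indicator C (X (s + t) \<omega>) \<partial>M)
      = (\<integral>\<omega>. indicator C (X s \<omega>) * measure_pmf.prob (P t (X s \<omega>)) C \<partial>M)"
    by (rule markov_process_conditional[where P=P, OF ps X cond st C])
  also have "\<dots> = (\<integral>\<omega>. indicator C (X s \<omega>) \<partial>M)"
    by (intro Bochner_Integration.integral_cong) (auto simp: indicator_def stay)
  finally have "(\<integral>\<omega>. indicator C (X s \<omega>) * indicator C (X (s + t) \<omega>) \<partial>M)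
      = (\<integral>\<omega>. (indicator C (X s \<omega>) :: real) \<partial>M)" .
  then have "(\<integral>\<omega>. ?g \<omega> \<partial>M) = 0" using int by simp
  moreover have "integrable M ?g" using int by simp
  ultimately have "AE \<omega> in M. ?g \<omega> = 0"
    by (subst (asm) integral_nonneg_eq_0_iff_AE) (auto simp: indicator_def)
  then show ?thesis by eventually_elim (auto simp: indicator_def split: if_splits)
qed

text \<open>
  For discrete right-continuous paths, convergence can be read off at rational times, of which
  there are countably many.
\<close>

lemma right_continuous_tendsto_iff:
  fixes X :: "real \<Rightarrow> 'a \<Rightarrow> nat"
  assumes rc: "\<And>t. t \<ge> 0 \<Longrightarrow> \<forall>\<^sub>F s in at_right t. X s = X t"
  shows "((\<lambda>t. X t z) \<longlongrightarrow> c) at_top \<longleftrightarrow> (\<exists>n::nat. \<forall>r\<in>{r\<in>\<rat>. real n \<le> r}. X r z = c)"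
proof
  assume "((\<lambda>t. X t z) \<longlongrightarrow> c) at_top"
  then have "\<forall>\<^sub>F t in at_top. X t z = c" by (simp add: tendsto_discrete)
  then obtain T where T: "\<And>t. t \<ge> T \<Longrightarrow> X t z = c" by (auto simp: eventually_at_top_linorder)
  obtain n :: nat where "T \<le> real n" using real_arch_simple by blast
  then show "\<exists>n::nat. \<forall>r\<in>{r\<in>\<rat>. real n \<le> r}. X r z = c"
    using T by (intro exI[of _ n]) auto
next
  assume "\<exists>n::nat. \<forall>r\<in>{r\<in>\<rat>. real n \<le> r}. X r z = c"
  then obtain n :: nat where n: "\<And>r. r \<in> \<rat> \<Longrightarrow> real n \<le> r \<Longrightarrow> X r z = c" by auto
  have "X t z = c" if t: "t \<ge> real n" for t
  proof -
    have "t \<ge> 0" using t by linarith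
    then obtain b where b: "b > t" "\<And>s. t < s \<Longrightarrow> s < b \<Longrightarrow> X s = X t"
      using rc[of t] unfolding eventually_at_right_field by blast
    then obtain r where "r \<in> \<rat>" "t < r" "r < b" using Rats_dense_in_real by blast
    then show ?thesis using n[of r] b(2)[of r] t by simp
  qed
  then have "\<forall>\<^sub>F t in at_top. X t z = c" by (auto simp: eventually_at_top_linorder)
  then show "((\<lambda>t. X t z) \<longlongrightarrow> c) at_top" by (rule tendsto_eventually)
qed

text \<open>
  The limit state is only meaningful on paths that converge, and the measure of a non-measurable
  set would be 0 by convention, so what happens on the exceptional null set matters. On a path
  that does not converge, \<open>Lim\<close> is one fixed default value, the same for all such paths.
\<close>

lemma limit_event_measurable:
  fixes X :: "real \<Rightarrow> 'w \<Rightarrow> 'a \<Rightarrow> nat"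
  assumes X: "\<And>t. t \<ge> 0 \<Longrightarrow> X t \<in> measurable M (count_space S)"
    and rc: "\<And>\<omega> t. \<omega> \<in> space M \<Longrightarrow> t \<ge> 0 \<Longrightarrow> \<forall>\<^sub>F s in at_right t. X s \<omega> = X t \<omega>"
  shows "{\<omega> \<in> space M. limit_state X \<omega> z = k} \<in> sets M"
proof -
  let ?conv = "\<lambda>c \<omega>. \<exists>n::nat. \<forall>r\<in>{r\<in>\<rat>. real n \<le> r}. X r \<omega> z = c"
  \<comment> \<open>the value of \<open>Lim\<close> on a path without a limit\<close>
  define c0 where "c0 = (THE l :: nat. False)"
  have iff: "((\<lambda>t. X t \<omega> z) \<longlongrightarrow> c) at_top \<longleftrightarrow> ?conv c \<omega>" if "\<omega> \<in> space M" for c \<omega>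
    using rc[OF that] by (rule right_continuous_tendsto_iff)
  have lim: "limit_state X \<omega> z = k \<longleftrightarrow> ?conv k \<omega> \<or> ((\<forall>c. \<not> ?conv c \<omega>) \<and> c0 = k)"
    if \<omega>: "\<omega> \<in> space M" for \<omega>
  proof (cases "\<exists>c. ?conv c \<omega>")
    case True
    then obtain c where c: "?conv c \<omega>" by blast
    then have t: "((\<lambda>t. X t \<omega> z) \<longlongrightarrow> c) at_top" using iff[OF \<omega>] by blast
    then have "limit_state X \<omega> z = c"
      unfolding limit_state_def by (intro tendsto_Lim) auto
    moreover have "?conv k \<omega> \<longleftrightarrow> c = k"
      using t iff[OF \<omega>, of k] tendsto_unique[OF _ t, of k] by auto
    ultimately show ?thesis using c by blast
  next
    case False
    then have "\<And>l. ((\<lambda>t. X t \<omega> z) \<longlongrightarrow> l) at_top \<longleftrightarrow> False" using iff[OF \<omega>] by blast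
    then have "limit_state X \<omega> z = c0"
      unfolding limit_state_def Topological_Spaces.Lim_def c0_def by simp
    then show ?thesis using False by blast
  qed
  have conv: "{\<omega> \<in> space M. ?conv c \<omega>} \<in> sets M" for c
  proof (intro sets.sets_Collect_countable_Ex sets.sets_Collect_countable_All')
    fix n r assume "r \<in> {r\<in>\<rat>. real n \<le> r}"
    then have "(\<lambda>\<omega>. X r \<omega>) \<in> measurable M (count_space S)"
      by (intro X) (auto intro: order_trans[OF of_nat_0_le_iff])
    then have "(\<lambda>\<omega>. X r \<omega> z) \<in> measurable M (count_space UNIV)"
      by (rule measurable_compose) simp
    then show "{\<omega> \<in> space M. X r \<omega> z = c} \<in> sets M" by measurable
  qed (auto intro: countable_subset[OF _ countable_rat])
  have "{\<omega> \<in> space M. limit_state X \<omega> z = k}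
      = {\<omega> \<in> space M. ?conv k \<omega> \<or> ((\<forall>c. \<not> ?conv c \<omega>) \<and> c0 = k)}"
    using lim by blast
  also have "\<dots> \<in> sets M"
    by (intro sets.sets_Collect_disj sets.sets_Collect_conj sets.sets_Collect_neg
        sets.sets_Collect_countable_All sets.sets_Collect_const conv)
  finally show ?thesis .
qed

text \<open>
  All sets \<open>D C m\<close> are kept, so almost surely the \<open>z\<close>-coordinate is nondecreasing and at most \<open>k\<close>
  along rational times. It is then eventually constant, by right continuity also along real times,
  and the limit equals \<open>k\<close> exactly if the path has entered \<open>D C k\<close> at some time. Dominated
  convergence turns this into a limit of transition probabilities.
\<close>

lemma markov_process_limit_probability:
  fixes X :: "real \<Rightarrow> 'w \<Rightarrow> 'a \<Rightarrow> nat" and z :: 'a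
  defines "D \<equiv> \<lambda>C m. {x \<in> C. m \<le> x z}"
  assumes mp: "markov_process S L M X"
    and C: "finite C" "C \<subseteq> S" "\<And>x. x \<in> C \<Longrightarrow> x z \<le> k"
    and LD: "\<And>m x. x \<in> D C m \<Longrightarrow> L (indicator (D C m)) x = 0"
    and x0: "x0 \<in> C" "AE \<omega> in M. X 0 \<omega> = x0"
  obtains P where "markov_semigroup S L P"
    "(\<lambda>n. measure_pmf.prob (P (real n) x0) (D C k))
       \<longlonglongrightarrow> measure M {\<omega> \<in> space M. limit_state X \<omega> z = k}"
proof -
  from mp have ps: "prob_space M"
    and X: "\<And>t. t \<ge> 0 \<Longrightarrow> X t \<in> measurable M (count_space S)"
    and rc: "\<And>\<omega> t. \<omega> \<in> space M \<Longrightarrow> t \<ge> 0 \<Longrightarrow> \<forall>\<^sub>F s in at_right t. X s \<omega> = X t \<omega>"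
    unfolding markov_process_def by simp_all
  obtain P where sg: "markov_semigroup S L P"
    and cond: "\<forall>s\<ge>0. \<forall>t\<ge>0. \<forall>f. bounded (f ` S) \<longrightarrow>
           (AE \<omega> in M. real_cond_exp M (past M S X s) (\<lambda>\<omega>'. f (X (s + t) \<omega>')) \<omega>
                        = measure_pmf.expectation (P t (X s \<omega>)) f)"
    using mp unfolding markov_process_def by (elim conjE exE) (rule that)
  interpret prob_space M by fact
  have cond': "AE \<omega> in M. real_cond_exp M (past M S X s) (\<lambda>\<omega>'. indicator B (X (s + t) \<omega>')) \<omega>
                        = measure_pmf.prob (P t (X s \<omega>)) B" if "s \<ge> 0" "t \<ge> 0" for s t B
  proof -
    have "bounded (indicator B ` S :: real set)"
      by (rule bounded_subset[of "{0, 1}"]) (auto simp: indicator_def)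
    from cond[rule_format, OF that this] show ?thesis by simp
  qed
  have D_C: "D C m \<subseteq> C" "finite (D C m)" for m using C(1) by (auto simp: D_def)
  have C_D: "C = D C 0" by (simp add: D_def)
  \<comment> \<open>conditioning on the sure event \<open>X 0 \<in> S\<close> gives the law of \<open>X t\<close> alone\<close>
  have law: "measure_pmf.prob (P t x0) B = (\<integral>\<omega>. indicator B (X t \<omega>) \<partial>M)" if t: "t \<ge> 0" for t B
  proof -
    have "(\<integral>\<omega>. indicator S (X 0 \<omega>) * indicator B (X (0 + t) \<omega>) \<partial>M)
        = (\<integral>\<omega>. indicator S (X 0 \<omega>) * measure_pmf.prob (P t (X 0 \<omega>)) B \<partial>M)"
      using t cond'[of 0 t B] by (intro markov_process_conditional[where P=P, OF ps X]) auto
    moreover have "(\<integral>\<omega>. indicator S (X 0 \<omega>) * indicator B (X (0 + t) \<omega>) \<partial>M) = (\<integral>\<omega>. (indicator B (X t \<omega>) :: real) \<partial>M)"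
      using measurable_space[OF X[of 0]] by (intro Bochner_Integration.integral_cong) auto
    moreover have "(\<integral>\<omega>. indicator S (X 0 \<omega>) * measure_pmf.prob (P t (X 0 \<omega>)) B \<partial>M)
        = (\<integral>\<omega>. measure_pmf.prob (P t x0) B \<partial>M)"
    proof (rule integral_cong_AE)
      show "(\<lambda>\<omega>. indicator S (X 0 \<omega>) * measure_pmf.prob (P t (X 0 \<omega>)) B) \<in> borel_measurable M"
        by (rule measurable_compose[OF X]) auto
      show "AE \<omega> in M. indicator S (X 0 \<omega>) * measure_pmf.prob (P t (X 0 \<omega>)) B = measure_pmf.prob (P t x0) B"
        using x0(2) by eventually_elim (use x0(1) C(2) in auto)
    qed simp
    ultimately show ?thesis by (simp add: prob_space)
  qed
  let ?Q = "{r\<in>\<rat>. 0 \<le> (r::real)}"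
  have Q: "countable ?Q" by (auto intro: countable_subset[OF _ countable_rat])
  have "AE \<omega> in M. \<forall>s\<in>?Q. \<forall>t\<in>?Q. \<forall>m. X s \<omega> \<in> D C m \<longrightarrow> X (s + t) \<omega> \<in> D C m"
    unfolding AE_ball_countable[OF Q] AE_all_countable
  proof (intro ballI allI)
    fix s t m assume st: "s \<in> ?Q" "t \<in> ?Q"
    have "measure_pmf.prob (P t x) (D C m) = 1" if "x \<in> D C m" for x
      using st D_C[of m] C(2) LD that by (intro markov_semigroup_finite_closed[OF sg]) auto
    then show "AE \<omega> in M. X s \<omega> \<in> D C m \<longrightarrow> X (s + t) \<omega> \<in> D C m"
      using st D_C[of m] C(2) by (intro markov_process_stays[OF ps X cond']) auto
  qed
  then have AE_lim: "AE \<omega> in M. (\<lambda>n. indicator (D C k) (X (real n) \<omega>) :: real)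
      \<longlonglongrightarrow> indicator {\<omega> \<in> space M. limit_state X \<omega> z = k} \<omega>"
    using x0(2) AE_space
  proof eventually_elim
    case (elim \<omega>)
    have in_C: "X r \<omega> \<in> C" if "r \<in> ?Q" for r
      using elim(1)[rule_format, of 0 r 0] elim(2) x0(1) that by (simp flip: C_D)
    define c where "c = Max ((\<lambda>r. X r \<omega> z) ` ?Q)"
    have fin: "finite ((\<lambda>r. X r \<omega> z) ` ?Q)"
      by (rule finite_subset[of _ "{..k}"]) (use in_C C(3) in auto)
    have "c \<in> (\<lambda>r. X r \<omega> z) ` ?Q" unfolding c_def by (intro Max_in fin) auto
    then obtain r0 where r0: "r0 \<in> ?Q" "X r0 \<omega> z = c" by auto
    have const: "X r \<omega> z = c" if r: "r \<in> \<rat>" "r0 \<le> r" for r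
    proof -
      have "X r0 \<omega> \<in> D C c" using r0 in_C by (auto simp: D_def)
      then have "X (r0 + (r - r0)) \<omega> \<in> D C c"
        using elim(1) r0 r by (metis (mono_tags, lifting) Rats_diff diff_ge_0_iff_ge mem_Collect_eq)
      moreover have "X r \<omega> z \<le> c"
        unfolding c_def using r r0 by (intro Max_ge fin imageI) auto
      ultimately show ?thesis by (simp add: D_def)
    qed
    obtain n0 :: nat where n0: "r0 \<le> real n0" using real_arch_simple by blast
    have "((\<lambda>t. X t \<omega> z) \<longlongrightarrow> c) at_top"
      using const n0 rc[OF elim(3)]
      by (subst right_continuous_tendsto_iff) (auto intro!: exI[of _ n0])
    then have lim: "limit_state X \<omega> z = c"
      unfolding limit_state_def by (intro tendsto_Lim) auto
    have "\<forall>\<^sub>F n in sequentially. indicator (D C k) (X (real n) \<omega>)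
        = (indicator {\<omega> \<in> space M. limit_state X \<omega> z = k} \<omega> :: real)"
      using eventually_ge_at_top[of n0]
    proof eventually_elim
      case (elim n)
      have "X (real n) \<omega> z = c" using const[of "real n"] n0 elim by simp
      moreover have "X (real n) \<omega> \<in> C" using in_C by simp
      ultimately show ?case
        using C(3)[of "X (real n) \<omega>"] lim \<open>\<omega> \<in> space M\<close> by (auto simp: D_def indicator_def)
    qed
    then show ?case by (rule tendsto_eventually)
  qed
  have meas: "{\<omega> \<in> space M. limit_state X \<omega> z = k} \<in> sets M"
    by (rule limit_event_measurable[OF X rc])
  have "(\<lambda>n. \<integral>\<omega>. (indicator (D C k) (X (real n) \<omega>) :: real) \<partial>M)
      \<longlonglongrightarrow> (\<integral>\<omega>. indicator {\<omega> \<in> space M. limit_state X \<omega> z = k} \<omega> \<partial>M)"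
  proof (rule integral_dominated_convergence[where w = "\<lambda>_. 1 :: real"])
    show "(\<lambda>\<omega>. indicator (D C k) (X (real n) \<omega>) :: real) \<in> borel_measurable M" for n
      by (rule measurable_compose[OF X]) auto
  qed (use meas AE_lim in auto)
  then have "(\<lambda>n. measure_pmf.prob (P (real n) x0) (D C k))
       \<longlonglongrightarrow> measure M {\<omega> \<in> space M. limit_state X \<omega> z = k}"
    using meas by (simp add: law)
  with sg show thesis by (rule that)
qed

section \<open>Uniformisation\<close>

text \<open>
  The Poisson law needs a positive rate, but the semigroup starts at time 0, where the rate is 0.
\<close>

definition poisson0 :: "real \<Rightarrow> nat pmf" where
  "poisson0 r = (if r \<le> 0 then return_pmf 0 else poisson_pmf r)"

lemma pmf_poisson0: "r \<ge> 0 \<Longrightarrow> pmf (poisson0 r) n = r ^ n / fact n * exp (- r)"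
  by (cases "r = 0") (auto simp: poisson0_def pmf_return indicator_def power_0_left)

text \<open>
  Convolution of Poisson laws, by the binomial theorem; it becomes the semigroup law.
\<close>

lemma poisson0_add:
  assumes "r \<ge> 0" "s \<ge> 0"
  shows "bind_pmf (poisson0 r) (\<lambda>m. map_pmf ((+) m) (poisson0 s)) = poisson0 (r + s)"
proof (rule pmf_eqI)
  fix k
  have shift: "pmf (map_pmf ((+) m) (poisson0 s)) k = (if m \<le> k then pmf (poisson0 s) (k - m) else 0)" for m
  proof (cases "m \<le> k")
    case True
    then have "(+) m -` {k} = {k - m}" by auto
    then show ?thesis using True by (simp add: pmf_map measure_pmf_single)
  next
    case False
    then have "(+) m -` {k} = {}" by auto
    then show ?thesis using False by (simp add: pmf_map)
  qed
  have "pmf (bind_pmf (poisson0 r) (\<lambda>m. map_pmf ((+) m) (poisson0 s))) k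
      = (\<Sum>m\<le>k. (if m \<le> k then pmf (poisson0 s) (k - m) else 0) * pmf (poisson0 r) m)"
    unfolding pmf_bind shift by (rule integral_measure_pmf_real) (auto split: if_splits)
  also have "\<dots> = (\<Sum>m\<le>k. exp (- (r + s)) / fact k * (of_nat (k choose m) * r ^ m * s ^ (k - m)))"
    using assms
    by (intro sum.cong refl) (simp add: pmf_poisson0 binomial_fact exp_add[symmetric] field_simps)
  also have "\<dots> = exp (- (r + s)) / fact k * (r + s) ^ k"
    by (simp add: binomial_ring sum_distrib_left)
  also have "\<dots> = pmf (poisson0 (r + s)) k" using assms by (simp add: pmf_poisson0)
  finally show "pmf (bind_pmf (poisson0 r) (\<lambda>m. map_pmf ((+) m) (poisson0 s))) k = pmf (poisson0 (r + s)) k" .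
qed

text \<open>
  To first order in \<open>t\<close> only the counts 0 and 1 matter: the counts from 2 on contribute at most
  \<open>B\<close> times their total probability \<open>1 - exp (- c t) - c t exp (- c t)\<close>, which is \<open>o(t)\<close>.
\<close>

lemma poisson0_expectation_derivative:
  assumes c: "c > 0" and B: "\<And>n. \<bar>a n\<bar> \<le> B"
  shows "((\<lambda>t. (measure_pmf.expectation (poisson0 (c * t)) a - a 0) / t) \<longlongrightarrow> c * (a 1 - a 0)) (at_right 0)"
proof -
  let ?e = "\<lambda>t. exp (- (c * t))"
  have "((\<lambda>t. exp (- (c * t))) has_real_derivative - c) (at 0)"
    by (auto intro!: derivative_eq_intros)
  then have "((\<lambda>t. (?e t - 1) / t) \<longlongrightarrow> - c) (at 0)"
    by (simp add: has_field_derivative_iff)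
  then have slope: "((\<lambda>t. (?e t - 1) / t) \<longlongrightarrow> - c) (at_right 0)"
    by (rule tendsto_mono[rotated]) (simp add: at_le)
  have "((\<lambda>t. ?e t) \<longlongrightarrow> exp (- (c * 0))) (at_right 0)"
    by (intro tendsto_intros)
  then have e1: "((\<lambda>t. ?e t) \<longlongrightarrow> 1) (at_right 0)" by simp
  let ?main = "\<lambda>t. (?e t - 1) / t * a 0 + c * ?e t * a 1"
  let ?tail = "\<lambda>t. - ((?e t - 1) / t) - c * ?e t"
  have main: "(?main \<longlongrightarrow> - c * a 0 + c * 1 * a 1) (at_right 0)"
    by (intro tendsto_add tendsto_mult slope e1 tendsto_const)
  have "((\<lambda>t. B * ?tail t) \<longlongrightarrow> B * (- (- c) - c * 1)) (at_right 0)"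
    by (intro tendsto_diff tendsto_minus tendsto_mult slope e1 tendsto_const)
  then have tail: "((\<lambda>t. B * ?tail t) \<longlongrightarrow> 0) (at_right 0)" by simp
  have "((\<lambda>t. (measure_pmf.expectation (poisson0 (c * t)) a - a 0) / t - ?main t) \<longlongrightarrow> 0) (at_right 0)"
  proof (rule Lim_null_comparison[OF _ tail])
    show "\<forall>\<^sub>F t in at_right 0. norm ((measure_pmf.expectation (poisson0 (c * t)) a - a 0) / t - ?main t) \<le> B * ?tail t"
      using eventually_at_right_less[of "0::real"]
    proof eventually_elim
      case (elim t)
      let ?p = "measure_pmf (poisson0 (c * t))"
      let ?lo = "\<lambda>f n. f n * indicator {0, 1} n" and ?hi = "\<lambda>f n. f n * indicator {2..} n :: real"
      have int: "integrable ?p (?hi a)" "integrable ?p (?lo a)" "integrable ?p a"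
        using B order_trans[OF abs_ge_zero B]
        by (auto intro!: integrable_pmf_bounded[where B=B] simp: indicator_def)
      have int1: "integrable ?p (\<lambda>n. indicator {2..} n :: real)"
        by (auto intro!: integrable_pmf_bounded[where B=1] simp: indicator_def)
      have low: "(\<integral>n. ?lo f n \<partial>?p) = f 0 * ?e t + f 1 * (c * t * ?e t)" for f
        using elim c by (subst integral_measure_pmf_real[of "{0, 1}"]) (auto simp: pmf_poisson0 indicator_def)
      have split: "f n = ?lo f n + ?hi f n" for f :: "nat \<Rightarrow> real" and n
        by (auto simp: indicator_def)
      have "measure_pmf.expectation (poisson0 (c * t)) a = (\<integral>n. ?lo a n + ?hi a n \<partial>?p)"
        by (intro Bochner_Integration.integral_cong refl split)
      also have "\<dots> = (\<integral>n. ?lo a n \<partial>?p) + (\<integral>n. ?hi a n \<partial>?p)"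
        using int by simp
      finally have E: "measure_pmf.expectation (poisson0 (c * t)) a
          = a 0 * ?e t + a 1 * (c * t * ?e t) + (\<integral>n. ?hi a n \<partial>?p)" by (simp only: low)
      have "1 = (\<integral>n. ?lo (\<lambda>_. 1) n + ?hi (\<lambda>_. 1) n \<partial>?p)"
        by (subst split[of "\<lambda>_. 1", symmetric]) simp
      also have "\<dots> = (\<integral>n. ?lo (\<lambda>_. 1) n \<partial>?p) + (\<integral>n. ?hi (\<lambda>_. 1) n \<partial>?p)"
        using int1 by (intro Bochner_Integration.integral_add)
          (auto intro!: integrable_pmf_bounded[where B=1] simp: indicator_def)
      finally have one: "(\<integral>n. indicator {2..} n \<partial>?p) = 1 - ?e t - c * t * ?e t"
        by (simp only: low) simp
      have "\<bar>\<integral>n. ?hi a n \<partial>?p\<bar> \<le> (\<integral>n. B * indicator {2..} n \<partial>?p)"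
      proof (rule order_trans[OF integral_abs_bound integral_mono])
        show "integrable ?p (\<lambda>n. \<bar>?hi a n\<bar>)" using int by simp
        show "integrable ?p (\<lambda>n. B * indicator {2..} n)" using int1 by simp
        show "\<bar>?hi a n\<bar> \<le> B * indicator {2..} n" for n using B[of n] by (simp add: indicator_def)
      qed
      also have "\<dots> = B * (1 - ?e t - c * t * ?e t)" using one by simp
      finally have bound: "\<bar>\<integral>n. ?hi a n \<partial>?p\<bar> \<le> B * (1 - ?e t - c * t * ?e t)" .
      have "(measure_pmf.expectation (poisson0 (c * t)) a - a 0) / t - ?main t = (\<integral>n. ?hi a n \<partial>?p) / t"
        unfolding E using elim by (simp add: field_simps)
      moreover have "B * ?tail t = B * (1 - ?e t - c * t * ?e t) / t"
        using elim by (simp add: field_simps)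
      ultimately show ?case using bound elim by (simp add: divide_right_mono)
    qed
  qed
  from tendsto_add[OF this main] show ?thesis by (simp add: algebra_simps)
qed

text \<open>
  Generators of the form \<open>c (K - 1)\<close> with a transition kernel \<open>K\<close>: jumps according to \<open>K\<close> at the
  times of a Poisson process of rate \<open>c\<close>. A generator with several kinds of jumps is of this form
  too, by the closure under addition below.
\<close>

definition jump_generator :: "'s set \<Rightarrow> (('s \<Rightarrow> real) \<Rightarrow> 's \<Rightarrow> real) \<Rightarrow> bool" where
  "jump_generator S L \<longleftrightarrow> (\<exists>c>0. \<exists>K. \<forall>x\<in>S. set_pmf (K x) \<subseteq> S \<and>
     (\<forall>f. L f x = c * (measure_pmf.expectation (K x) f - f x)))"

lemma jump_generator_kernel:
  assumes "c \<ge> 0" "\<And>x. x \<in> S \<Longrightarrow> set_pmf (K x) \<subseteq> S"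
    and "\<And>x f. x \<in> S \<Longrightarrow> L f x = c * (measure_pmf.expectation (K x) f - f x)"
  shows "jump_generator S L"
proof (cases "c = 0")
  case True
  \<comment> \<open>a clock must have a positive rate; one that triggers no change represents rate 0\<close>
  then show ?thesis
    using assms unfolding jump_generator_def
    by (intro exI[of _ 1] conjI exI[of _ return_pmf]) auto
next
  case False
  then show ?thesis using assms unfolding jump_generator_def by (intro exI[of _ c] conjI exI[of _ K]) auto
qed

text \<open>
  Superpose the two Poisson clocks: the combined clock has rate \<open>c1 + c2\<close>, and each ring belongs
  to the first process with probability \<open>c1 / (c1 + c2)\<close>.
\<close>

lemma jump_generator_add:
  assumes S: "finite S" and "jump_generator S L1" "jump_generator S L2"
  shows "jump_generator S (\<lambda>f x. L1 f x + L2 f x)"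
proof -
  from assms(2) obtain c1 K1 where 1: "c1 > 0" "\<And>x. x \<in> S \<Longrightarrow> set_pmf (K1 x) \<subseteq> S"
    "\<And>x f. x \<in> S \<Longrightarrow> L1 f x = c1 * (measure_pmf.expectation (K1 x) f - f x)"
    unfolding jump_generator_def by blast
  from assms(3) obtain c2 K2 where 2: "c2 > 0" "\<And>x. x \<in> S \<Longrightarrow> set_pmf (K2 x) \<subseteq> S"
    "\<And>x f. x \<in> S \<Longrightarrow> L2 f x = c2 * (measure_pmf.expectation (K2 x) f - f x)"
    unfolding jump_generator_def by blast
  let ?K = "\<lambda>x. bind_pmf (bernoulli_pmf (c1 / (c1 + c2))) (\<lambda>b. if b then K1 x else K2 x)"
  have q: "0 \<le> c1 / (c1 + c2)" "c1 / (c1 + c2) \<le> 1" using 1(1) 2(1) by auto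
  show ?thesis
  proof (rule jump_generator_kernel[where c = "c1 + c2" and K = ?K])
    show "set_pmf (?K x) \<subseteq> S" if "x \<in> S" for x
      using 1(2)[OF that] 2(2)[OF that] by (auto split: if_splits)
    show "L1 f x + L2 f x = (c1 + c2) * (measure_pmf.expectation (?K x) f - f x)" if x: "x \<in> S" for x f
    proof -
      have "measure_pmf.expectation (?K x) f
          = (\<Sum>b\<in>UNIV. pmf (bernoulli_pmf (c1 / (c1 + c2))) b *\<^sub>R measure_pmf.expectation (if b then K1 x else K2 x) f)"
        using 1(2)[OF x] 2(2)[OF x] S by (intro pmf_expectation_bind) (auto intro: finite_subset)
      also have "\<dots> = c1 / (c1 + c2) * measure_pmf.expectation (K1 x) f
          + (1 - c1 / (c1 + c2)) * measure_pmf.expectation (K2 x) f"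
        using q by (simp add: UNIV_bool)
      also have "1 - c1 / (c1 + c2) = c2 / (c1 + c2)"
        using 1(1) 2(1) by (simp add: field_simps)
      finally have "(c1 + c2) * measure_pmf.expectation (?K x) f
          = c1 * measure_pmf.expectation (K1 x) f + c2 * measure_pmf.expectation (K2 x) f"
        using 1(1) 2(1) by (simp add: distrib_left)
      then show ?thesis using 1(3)[OF x] 2(3)[OF x] by (simp add: algebra_simps)
    qed
  qed (use 1(1) 2(1) in simp)
qed

lemma jump_generator_sum:
  assumes "finite S" "finite A" "\<And>a. a \<in> A \<Longrightarrow> jump_generator S (L a)"
  shows "jump_generator S (\<lambda>f x. \<Sum>a\<in>A. L a f x)"
  using assms(2,3)
proof (induction A)
  case empty
  show ?case by (rule jump_generator_kernel[where c = 0 and K = return_pmf]) auto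
next
  case (insert a A)
  then show ?case using jump_generator_add[OF assms(1), of "L a"] by simp
qed

lemma jump_generator_cong:
  assumes "jump_generator S L" "\<And>x f. x \<in> S \<Longrightarrow> L' f x = L f x"
  shows "jump_generator S L'"
  using assms unfolding jump_generator_def by simp

text \<open>
  Uniformisation: \<open>P\<^sub>t\<close> is the law of the discrete chain with kernel \<open>K\<close> after a Poisson
  number of steps with mean \<open>c t\<close>. Testing the hypothesis on \<open>\<mu>\<close> with indicators gives
  \<open>\<mu> K = \<mu>\<close>, hence \<open>\<mu> P\<^sub>t = \<mu>\<close>.
\<close>

lemma jump_generator_stationary:
  assumes S: "finite S" and L: "jump_generator S L"
    and \<mu>: "set_pmf \<mu> \<subseteq> S" "\<And>f. (\<Sum>x\<in>S. pmf \<mu> x * L f x) = 0"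
  shows "stationary_distribution S L \<mu>"
proof -
  from L obtain c K where c: "c > 0" and KS: "\<And>x. x \<in> S \<Longrightarrow> set_pmf (K x) \<subseteq> S"
    and LK: "\<And>x f. x \<in> S \<Longrightarrow> L f x = c * (measure_pmf.expectation (K x) f - f x)"
    unfolding jump_generator_def by blast
  define step where "step = rec_nat return_pmf (\<lambda>_ Q x. bind_pmf (K x) Q)"
  have step_0: "step 0 = return_pmf" and step_Suc: "step (Suc n) x = bind_pmf (K x) (step n)" for n x
    by (simp_all add: step_def)
  have step_add: "bind_pmf (step m x) (step n) = step (m + n) x" for m n x
    by (induction m arbitrary: x) (simp_all add: step_0 step_Suc bind_return_pmf bind_assoc_pmf)
  have step_S: "set_pmf (step n x) \<subseteq> S" if "x \<in> S" for n x
    using that by (induction n arbitrary: x) (use KS in \<open>auto simp: step_0 step_Suc\<close>)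
  define P where "P t x = bind_pmf (poisson0 (c * t)) (\<lambda>n. step n x)" for t x
  have P_S: "set_pmf (P t x) \<subseteq> S" if "x \<in> S" for t x
    using step_S[OF that] by (auto simp: P_def)
  have "markov_semigroup S L P"
    unfolding markov_semigroup_def
  proof (intro conjI allI impI ballI)
    show "set_pmf (P t x) \<subseteq> S" if "x \<in> S" for t x by (rule P_S[OF that])
    show "P 0 x = return_pmf x" for x by (simp add: P_def poisson0_def bind_return_pmf step_0)
    show "P (s + t) x = bind_pmf (P s x) (P t)" if "s \<ge> 0" "t \<ge> 0" for s t x
    proof -
      have "P (s + t) x = bind_pmf (poisson0 (c * s)) (\<lambda>m. bind_pmf (poisson0 (c * t)) (\<lambda>n. step (m + n) x))"
        unfolding P_def distrib_left using that c
        by (subst poisson0_add[symmetric]) (auto simp: bind_assoc_pmf bind_map_pmf)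
      also have "\<dots> = bind_pmf (poisson0 (c * s)) (\<lambda>m. bind_pmf (step m x) (\<lambda>y. bind_pmf (poisson0 (c * t)) (\<lambda>n. step n y)))"
        by (subst bind_commute_pmf) (simp add: step_add)
      also have "\<dots> = bind_pmf (P s x) (P t)" by (simp add: P_def[abs_def] bind_assoc_pmf)
      finally show ?thesis .
    qed
    show "((\<lambda>t. (measure_pmf.expectation (P t x) f - f x) / t) \<longlongrightarrow> L f x) (at_right 0)"
      if x: "x \<in> S" for f x
    proof -
      let ?a = "\<lambda>n. measure_pmf.expectation (step n x) f"
      have a: "?a n = (\<Sum>y\<in>S. f y * pmf (step n x) y)" for n
        using step_S[OF x] S by (intro integral_measure_pmf_real) auto
      have bound: "\<bar>?a n\<bar> \<le> (\<Sum>y\<in>S. \<bar>f y\<bar>)" for n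
        unfolding a by (intro order_trans[OF sum_abs] sum_mono)
          (auto simp: abs_mult pmf_le_1 intro: mult_left_le)
      have "measure_pmf.expectation (P t x) f = measure_pmf.expectation (poisson0 (c * t)) ?a" for t
      proof -
        have "measure_pmf.expectation (P t x) f = (\<Sum>y\<in>S. f y * pmf (P t x) y)"
          using P_S[OF x] S by (intro integral_measure_pmf_real) auto
        also have "\<dots> = (\<Sum>y\<in>S. \<integral>n. f y * pmf (step n x) y \<partial>measure_pmf (poisson0 (c * t)))"
          by (simp add: P_def pmf_bind)
        also have "\<dots> = (\<integral>n. (\<Sum>y\<in>S. f y * pmf (step n x) y) \<partial>measure_pmf (poisson0 (c * t)))"
          by (intro Bochner_Integration.integral_sum[symmetric] integrable_mult_right
              integrable_pmf_bounded[where B=1]) (simp add: pmf_le_1)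
        finally show ?thesis by (simp only: a)
      qed
      then show ?thesis
        using poisson0_expectation_derivative[OF c, of ?a, OF bound]
        by (simp add: step_0 step_Suc LK[OF x] bind_return_pmf')
    qed
  qed
  moreover have "bind_pmf \<mu> (P t) = \<mu>" for t
  proof -
    have K: "bind_pmf \<mu> K = \<mu>"
    proof (rule pmf_eqI)
      fix y
      have "pmf (bind_pmf \<mu> K) y = (\<Sum>x\<in>S. pmf (K x) y * pmf \<mu> x)"
        unfolding pmf_bind using \<mu>(1) S by (intro integral_measure_pmf_real) auto
      moreover have "c * ((\<Sum>x\<in>S. pmf (K x) y * pmf \<mu> x) - (\<Sum>x\<in>S. indicator {y} x * pmf \<mu> x)) = 0"
        using \<mu>(2)[of "indicator {y}"]
        by (simp add: LK measure_pmf_single sum_distrib_left sum_subtractf algebra_simps cong: sum.cong)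
      moreover have "(\<Sum>x\<in>S. indicator {y} x * pmf \<mu> x) = pmf \<mu> y"
        using \<mu>(1) S by (cases "y \<in> S") (auto simp: indicator_def if_distrib set_pmf_iff cong: if_cong)
      ultimately show "pmf (bind_pmf \<mu> K) y = pmf \<mu> y" using c by simp
    qed
    have "bind_pmf \<mu> (step n) = \<mu>" for n
      by (induction n) (simp_all add: step_0 step_Suc bind_return_pmf' K flip: bind_assoc_pmf)
    then show ?thesis unfolding P_def by (subst bind_commute_pmf) simp
  qed
  ultimately show ?thesis using \<mu>(1) unfolding stationary_distribution_def by blast
qed

section \<open>Configurations as sets of occupied sites\<close>

definition ind :: "nat set \<Rightarrow> nat \<Rightarrow> nat" where
  "ind I = (\<lambda>x. if x \<in> I then 1 else 0)"

lemma ind_eq_iff [simp]: "ind I = ind J \<longleftrightarrow> I = J"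
  by (auto simp: ind_def fun_eq_iff split: if_splits)

lemma inj_on_ind: "inj_on ind A"
  by (auto simp: inj_on_def)

lemma support_ind [simp]: "{x. ind I x = 1} = I" "{x. ind I x = Suc 0} = I"
  by (auto simp: ind_def)

abbreviation site_swap :: "nat \<Rightarrow> nat \<Rightarrow> nat \<Rightarrow> nat" where
  "site_swap \<equiv> Transposition.transpose"

lemma mem_site_swap_image: "z \<in> site_swap x y ` I \<longleftrightarrow> site_swap x y z \<in> I"
  by (metis imageE image_eqI transpose_involutory)

lemma card_site_swap_image: "card (site_swap x y ` B) = card B"
  by (intro card_image inj_onI) (metis transpose_involutory)

section \<open>Stirring with reservoirs: irreducibility\<close>

locale reservoir_graph =
  fixes N :: nat and E :: "nat set set" and w :: "nat \<Rightarrow> nat \<Rightarrow> real" and \<omega>L \<omega>R :: real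
  assumes N_ge_2: "2 \<le> N"
    and graph: "conductance_graph {1..N - 1} E w"
    and \<omega>L_pos: "0 < \<omega>L" and \<omega>R_pos: "0 < \<omega>R"
begin

definition V :: "nat set" where "V = {1..N - 1}"

definition oriented_edges :: "(nat \<times> nat) set" where
  "oriented_edges = {(x, y). x < y \<and> {x, y} \<in> E}"

text \<open>
  On 0-1 configurations a jump of a particle along an edge is the same as an exchange of the
  contents of its two ends, so the bulk dynamics acts on sets of occupied sites by transpositions.
\<close>

definition stirring_generator :: "(nat set \<Rightarrow> real) \<Rightarrow> nat set \<Rightarrow> real" where
  "stirring_generator g I =
     (\<Sum>(x, y)\<in>oriented_edges. w x y * (g (site_swap x y ` I) - g I))"

text \<open>
  The exclusion process with reservoir densities \<open>a\<close> (left) and \<open>b\<close> (right), in terms of the set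
  of occupied sites. The case \<open>a = 0\<close>, \<open>b = 1\<close> is the extreme process.
\<close>

definition set_generator :: "real \<Rightarrow> real \<Rightarrow> (nat set \<Rightarrow> real) \<Rightarrow> nat set \<Rightarrow> real" where
  "set_generator a b g I =
     stirring_generator g I
     + \<omega>L * ((1 - a) * (g (I - {1}) - g I) + a * (g (insert 1 I) - g I))
     + \<omega>R * ((1 - b) * (g (I - {N - 1}) - g I) + b * (g (insert (N - 1) I) - g I))"

text \<open>
  The dual process, recorded by the set of particles still in the bulk: a particle that reaches
  the right end is forgotten, and one that reaches the left end makes the function 0, as then not
  all particles can be absorbed on the right.
\<close>

definition killed_generator :: "(nat set \<Rightarrow> real) \<Rightarrow> nat set \<Rightarrow> real" where
  "killed_generator h J =
     stirring_generator h J
     - \<omega>L * (if 1 \<in> J then h J else 0)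
     + \<omega>R * (h (J - {N - 1}) - h J)"

lemma finite_V [simp]: "finite V" and sites_in_V: "1 \<in> V" "N - 1 \<in> V" "0 \<notin> V" "N \<notin> V"
  using N_ge_2 by (auto simp: V_def)

lemma oriented_edgesD:
  assumes "(x, y) \<in> oriented_edges"
  shows "x \<in> V" "y \<in> V" "x < y" "x \<noteq> y" "w x y > 0"
  using assms graph unfolding oriented_edges_def conductance_graph_def V_def by auto

lemma finite_oriented_edges [simp]: "finite oriented_edges"
  by (rule finite_subset[of _ "V \<times> V"]) (auto dest: oriented_edgesD)

lemma transpose_image_V:
  assumes "(x, y) \<in> oriented_edges" "I \<subseteq> V"
  shows "site_swap x y ` I \<subseteq> V"
  using assms oriented_edgesD[OF assms(1)] by (auto simp: Transposition.transpose_def)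

text \<open>
  Along a path in the graph, exchanges carry some particle to \<open>z\<close>, which keeps the number of
  particles; there it can be removed. So a member of minimal size is empty.
\<close>

lemma empty_in_closed_family:
  assumes A: "A \<subseteq> Pow V" "A \<noteq> {}" and z: "z \<in> V"
    and stir: "\<And>x y I. (x, y) \<in> oriented_edges \<Longrightarrow> I \<in> A \<Longrightarrow> site_swap x y ` I \<in> A"
    and remove: "\<And>I. I \<in> A \<Longrightarrow> I - {z} \<in> A"
  shows "{} \<in> A"
proof -
  obtain I where I: "I \<in> A" and least: "\<And>J. J \<in> A \<Longrightarrow> card I \<le> card J"
    using ex_has_least_nat[of "\<lambda>I. I \<in> A" _ card] A(2) by blast
  have "I = {}"
  proof (rule ccontr)
    assume "I \<noteq> {}"
    then obtain x where x: "x \<in> I" by blast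
    then have "(x, z) \<in> {(a, b). {a, b} \<in> E}\<^sup>*"
      using graph I A(1) z unfolding conductance_graph_def V_def by blast
    then have "\<exists>I'\<in>A. card I' = card I \<and> z \<in> I'"
    proof induction
      case base
      then show ?case using I x by blast
    next
      case (step y y')
      then obtain I' where I': "I' \<in> A" "card I' = card I" "y \<in> I'" by blast
      have "y \<noteq> y'" using step.hyps graph by (auto simp: conductance_graph_def)
      then have "(y, y') \<in> oriented_edges \<or> (y', y) \<in> oriented_edges"
        using step.hyps by (auto simp: oriented_edges_def insert_commute)
      then have "site_swap y y' ` I' \<in> A"
        using stir I'(1) by (metis Transposition.transpose_commute)
      moreover have "card (site_swap y y' ` I') = card I" "y' \<in> site_swap y y' ` I'"
        using I' by (auto simp: card_image intro: image_eqI[of _ _ y])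
      ultimately show ?case by blast
    qed
    then obtain I' where I': "I' \<in> A" "card I' = card I" "z \<in> I'" by blast
    have "finite I'" using A(1) I'(1) finite_subset[OF _ finite_V] by blast
    then have "card (I' - {z}) < card I"
      using I'(2,3) by (metis card_Diff1_less)
    then show False using least[OF remove[OF I'(1)]] by simp
  qed
  then show ?thesis using I by simp
qed

text \<open>
  Apply the previous lemma twice: to \<open>A\<close> with removal at 1, and to the complement of \<open>A\<close> with
  removal at \<open>N - 1\<close>. The complement is closed under exchanges because they are involutions, and
  under removal at \<open>N - 1\<close> because \<open>A\<close> is closed under insertion there. If it were nonempty, both
  would contain the empty set.
\<close>

lemma closed_family_full:
  assumes A: "A \<subseteq> Pow V" "A \<noteq> {}"
    and stir: "\<And>x y I. (x, y) \<in> oriented_edges \<Longrightarrow> I \<in> A \<Longrightarrow> site_swap x y ` I \<in> A"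
    and remove: "\<And>I. I \<in> A \<Longrightarrow> I - {1} \<in> A"
    and insert: "\<And>I. I \<in> A \<Longrightarrow> insert (N - 1) I \<in> A"
  shows "A = Pow V"
proof (rule ccontr)
  assume "A \<noteq> Pow V"
  then have ne: "Pow V - A \<noteq> {}" using A by blast
  have "{} \<in> Pow V - A"
  proof (rule empty_in_closed_family[OF _ ne sites_in_V(2)])
    show "site_swap x y ` I \<in> Pow V - A" if "(x, y) \<in> oriented_edges" "I \<in> Pow V - A" for x y I
      using that transpose_image_V[OF that(1), of I] stir[OF that(1), of "site_swap x y ` I"]
      by (auto simp: image_image)
    show "I - {N - 1} \<in> Pow V - A" if I: "I \<in> Pow V - A" for I
    proof (cases "N - 1 \<in> I")
      case True
      then show ?thesis using I insert[of "I - {N - 1}"] by (auto simp: insert_absorb)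
    next
      case False
      then show ?thesis using I by simp
    qed
  qed auto
  moreover have "{} \<in> A"
    using empty_in_closed_family[OF A sites_in_V(1) stir remove] by blast
  ultimately show False by blast
qed

text \<open>
  Test invariance with the indicator of \<open>A = {\<sigma> > 0}\<close>. Inside \<open>A\<close> the generator can only
  decrease this indicator and \<open>\<sigma> > 0\<close>; outside it can only increase it and
  \<open>\<sigma> \<le> 0\<close>. So every term is nonpositive and hence 0, which means that no transition
  leaves \<open>A\<close>, and \<open>A\<close> is everything by irreducibility.
\<close>

lemma invariant_signed_measure_positive:
  assumes ab: "0 \<le> a" "a < 1" "0 < b" "b \<le> 1"
    and inv: "\<And>g. (\<Sum>I\<in>Pow V. \<sigma> I * set_generator a b g I) = 0"
    and pos: "I0 \<subseteq> V" "\<sigma> I0 > 0"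
  shows "\<forall>I\<in>Pow V. \<sigma> I > 0"
proof -
  define A where "A = {I \<in> Pow V. \<sigma> I > 0}"
  define g where "g = (\<lambda>I. of_bool (I \<in> A) :: real)"
  have stir_le: "stirring_generator g I \<le> 0" if "I \<in> A" for I
    unfolding stirring_generator_def
    by (rule sum_nonpos) (use that in \<open>auto simp: g_def mult_le_0_iff dest: oriented_edgesD(5)\<close>)
  have stir_ge: "stirring_generator g I \<ge> 0" if "I \<notin> A" for I
    unfolding stirring_generator_def
    by (rule sum_nonneg) (use that in \<open>auto simp: g_def dest: oriented_edgesD(5)\<close>)
  have le: "set_generator a b g I \<le> 0" if I: "I \<in> A" for I
  proof -
    have "(1 - a) * (g (I - {1}) - g I) + a * (g (insert 1 I) - g I) \<le> 0"
      "(1 - b) * (g (I - {N - 1}) - g I) + b * (g (insert (N - 1) I) - g I) \<le> 0"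
      using ab I by (auto simp: g_def)
    then have "\<omega>L * ((1 - a) * (g (I - {1}) - g I) + a * (g (insert 1 I) - g I)) \<le> 0"
      "\<omega>R * ((1 - b) * (g (I - {N - 1}) - g I) + b * (g (insert (N - 1) I) - g I)) \<le> 0"
      using \<omega>L_pos \<omega>R_pos by (simp_all add: mult_le_0_iff)
    with stir_le[OF I] show ?thesis unfolding set_generator_def by linarith
  qed
  have ge: "set_generator a b g I \<ge> 0" if I: "I \<notin> A" for I
    using stir_ge[OF I] ab \<omega>L_pos \<omega>R_pos I unfolding set_generator_def by (auto simp: g_def)
  have "\<sigma> I * set_generator a b g I \<le> 0" if "I \<in> Pow V" for I
    using that le[of I] ge[of I] by (cases "I \<in> A") (auto simp: A_def mult_le_0_iff)
  then have "\<forall>I\<in>Pow V. \<sigma> I * set_generator a b g I = 0"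
    using inv[of g] sum_nonneg_eq_0_iff[of "Pow V" "\<lambda>I. - (\<sigma> I * set_generator a b g I)"]
    by (auto simp: sum_negf)
  then have zero: "set_generator a b g I = 0" if "I \<in> A" for I
    using that by (force simp: A_def)
  have parts: "stirring_generator g I = 0 \<and> I - {1} \<in> A \<and> insert (N - 1) I \<in> A" if I: "I \<in> A" for I
  proof -
    let ?l = "(1 - a) * (g (I - {1}) - g I)" and ?l' = "a * (g (insert 1 I) - g I)"
    let ?r = "(1 - b) * (g (I - {N - 1}) - g I)" and ?r' = "b * (g (insert (N - 1) I) - g I)"
    have neg: "?l \<le> 0" "?l' \<le> 0" "?r \<le> 0" "?r' \<le> 0"
      using ab I by (auto simp: g_def)
    have "\<omega>L * (?l + ?l') \<le> 0" "\<omega>R * (?r + ?r') \<le> 0"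
      using \<omega>L_pos \<omega>R_pos by (intro mult_nonneg_nonpos add_nonpos_nonpos neg; simp)+
    then have z: "stirring_generator g I = 0" "\<omega>L * (?l + ?l') = 0" "\<omega>R * (?r + ?r') = 0"
      using zero[OF I] stir_le[OF I] unfolding set_generator_def by linarith+
    then have "?l + ?l' = 0" "?r + ?r' = 0" using \<omega>L_pos \<omega>R_pos by simp_all
    then have "?l = 0" "?r' = 0" using neg by linarith+
    then show ?thesis using z(1) ab I by (auto simp: g_def split: if_splits)
  qed
  have "A = Pow V"
  proof (rule closed_family_full)
    show "A \<subseteq> Pow V" "A \<noteq> {}" using pos by (auto simp: A_def)
    show "site_swap x y ` I \<in> A" if e: "(x, y) \<in> oriented_edges" and I: "I \<in> A" for x y I
    proof -
      have "\<forall>e\<in>oriented_edges. (case e of (x, y) \<Rightarrow> - (w x y * (g (site_swap x y ` I) - g I))) = 0"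
        using parts[OF I]
        by (subst sum_nonneg_eq_0_iff[symmetric])
          (use I in \<open>auto simp: stirring_generator_def g_def mult_le_0_iff case_prod_unfold sum_negf
            dest: oriented_edgesD(5)\<close>)
      with e oriented_edgesD(5)[OF e] I show ?thesis by (fastforce simp: g_def split: if_splits)
    qed
  qed (use parts in blast)+
  then show ?thesis by (auto simp: A_def)
qed

lemma invariant_signed_measure_zero:
  assumes ab: "0 \<le> a" "a < 1" "0 < b" "b \<le> 1"
    and inv: "\<And>g. (\<Sum>I\<in>Pow V. \<sigma> I * set_generator a b g I) = 0"
    and total: "(\<Sum>I\<in>Pow V. \<sigma> I) = 0" and "I \<subseteq> V"
  shows "\<sigma> I = 0"
proof (rule ccontr)
  assume "\<sigma> I \<noteq> 0"
  then consider "\<sigma> I > 0" | "- \<sigma> I > 0" by linarith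
  then show False
  proof cases
    case 1
    have "\<forall>I\<in>Pow V. \<sigma> I > 0"
      by (rule invariant_signed_measure_positive[OF ab inv assms(7) 1])
    then have "(\<Sum>I\<in>Pow V. \<sigma> I) > 0" by (intro sum_pos) auto
    then show False using total by simp
  next
    case 2
    have "\<forall>I\<in>Pow V. - \<sigma> I > 0"
      using inv assms(7) 2
      by (intro invariant_signed_measure_positive[OF ab, of "\<lambda>I. - \<sigma> I"]) (simp_all add: sum_negf)
    then have "(\<Sum>I\<in>Pow V. - \<sigma> I) > 0" by (intro sum_pos) auto
    then show False using total by (simp add: sum_negf)
  qed
qed

section \<open>Duality between containment and the killed process\<close>

text \<open>
  Duality: exchanging two sites in \<open>I\<close> has the same effect on the truth of \<open>J \<subseteq> I\<close> as
  exchanging them in \<open>J\<close>; emptying site 1 makes it false if \<open>1 \<in> J\<close>; filling site \<open>N - 1\<close>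
  amounts to dropping \<open>N - 1\<close> from \<open>J\<close>.
\<close>

lemma set_generator_containment:
  "set_generator 0 1 (\<lambda>I. of_bool (J \<subseteq> I)) I = killed_generator (\<lambda>K. of_bool (K \<subseteq> I)) J"
proof -
  have "(J \<subseteq> site_swap x y ` I) = (site_swap x y ` J \<subseteq> I)" for x y
  proof -
    have invol: "site_swap x y ` site_swap x y ` A = A" for A
      by (simp add: image_image)
    show ?thesis
      using image_mono[of J "site_swap x y ` I" "site_swap x y"]
        image_mono[of "site_swap x y ` J" I "site_swap x y"] unfolding invol by blast
  qed
  then have "stirring_generator (\<lambda>I. of_bool (J \<subseteq> I)) I = stirring_generator (\<lambda>K. of_bool (K \<subseteq> I)) J"
    unfolding stirring_generator_def by simp
  moreover have "(J \<subseteq> I - {1}) = (J \<subseteq> I \<and> 1 \<notin> J)" "(J \<subseteq> insert (N - 1) I) = (J - {N - 1} \<subseteq> I)"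
    by auto
  ultimately show ?thesis
    unfolding set_generator_def killed_generator_def by auto
qed

lemma stirring_generator_sum:
  "stirring_generator (\<lambda>I. \<Sum>j\<in>X. c j * g j I) I = (\<Sum>j\<in>X. c j * stirring_generator (g j) I)"
proof -
  have "stirring_generator (\<lambda>I. \<Sum>j\<in>X. c j * g j I) I
      = (\<Sum>e\<in>oriented_edges. \<Sum>j\<in>X. c j *
          (w (fst e) (snd e) * (g j (site_swap (fst e) (snd e) ` I) - g j I)))"
    unfolding stirring_generator_def case_prod_unfold
    by (intro sum.cong refl) (simp add: sum_subtractf[symmetric] sum_distrib_left algebra_simps)
  also have "\<dots> = (\<Sum>j\<in>X. c j * stirring_generator (g j) I)"
    unfolding stirring_generator_def case_prod_unfold sum_distrib_left by (rule sum.swap)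
  finally show ?thesis .
qed

lemma set_generator_sum:
  "set_generator a b (\<lambda>I. \<Sum>j\<in>X. c j * g j I) I = (\<Sum>j\<in>X. c j * set_generator a b (g j) I)"
unfolding set_generator_def stirring_generator_sum
  by (simp add: sum.distrib sum_subtractf sum_distrib_left algebra_simps)

lemma killed_generator_sum:
  "killed_generator (\<lambda>I. \<Sum>j\<in>X. c j * g j I) I = (\<Sum>j\<in>X. c j * killed_generator (g j) I)"
unfolding killed_generator_def stirring_generator_sum
  by (simp add: sum.distrib sum_subtractf sum_distrib_left algebra_simps)

lemma set_generator_cong:
  assumes "\<And>I. I \<subseteq> V \<Longrightarrow> g I = g' I" "I \<subseteq> V"
  shows "set_generator a b g I = set_generator a b g' I"
proof -
  have "stirring_generator g I = stirring_generator g' I"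
    unfolding stirring_generator_def
    using assms transpose_image_V by (intro sum.cong refl) (auto simp: case_prod_unfold)
  moreover have "g (I - {z}) = g' (I - {z})" "g I = g' I" for z using assms by (metis Diff_subset subset_trans)+
  moreover have "g (insert 1 I) = g' (insert 1 I)" "g (insert (N - 1) I) = g' (insert (N - 1) I)"
    using assms sites_in_V by auto
  ultimately show ?thesis unfolding set_generator_def by simp
qed

text \<open>
  No transition of the killed process increases the number of particles, so only sets of at most
  this size are seen.
\<close>

lemma killed_generator_cong:
  assumes "\<And>I. I \<subseteq> V \<Longrightarrow> card I \<le> card J \<Longrightarrow> g I = g' I" "J \<subseteq> V"
  shows "killed_generator g J = killed_generator g' J"
proof -
  have "stirring_generator g J = stirring_generator g' J"
    unfolding stirring_generator_def
    using assms transpose_image_V by (intro sum.cong refl) (auto simp: case_prod_unfold card_image)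
  moreover have "g (J - {z}) = g' (J - {z})" "g J = g' J" for z
    using assms finite_subset[OF assms(2)] by (auto intro!: assms(1) card_mono)
  ultimately show ?thesis unfolding killed_generator_def by simp
qed

lemma mobius_transform_invariant:
  assumes h: "\<And>J. J \<subseteq> V \<Longrightarrow> killed_generator h J = 0"
    and F: "\<And>I. F I = (\<Sum>J | J \<subseteq> V \<and> I \<subseteq> J. (-1) ^ card (J - I) * h J)"
  shows "(\<Sum>I\<in>Pow V. F I * set_generator 0 1 g I) = 0"
proof -
  have above: "(\<Sum>I\<in>Pow V. F I * of_bool (J \<subseteq> I)) = h J" if "J \<subseteq> V" for J
  proof -
    have "(\<Sum>I\<in>Pow V. F I * of_bool (J \<subseteq> I)) = (\<Sum>I | J \<subseteq> I \<and> I \<subseteq> V. F I)"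
      by (rule sum.mono_neutral_cong_right) auto
    then show ?thesis
      using sum_superset_mobius[OF finite_V that] by (simp add: F)
  qed
  have basis: "(\<Sum>I\<in>Pow V. F I * set_generator 0 1 (\<lambda>I. of_bool (J \<subseteq> I)) I) = 0" if "J \<subseteq> V" for J
  proof -
    have "(\<Sum>I\<in>Pow V. F I * set_generator 0 1 (\<lambda>I. of_bool (J \<subseteq> I)) I)
        = killed_generator (\<lambda>K. \<Sum>I\<in>Pow V. F I * of_bool (K \<subseteq> I)) J"
      unfolding set_generator_containment killed_generator_sum ..
    also have "\<dots> = killed_generator h J"
      using that by (intro killed_generator_cong above)
    finally show ?thesis using h[OF that] by simp
  qed
  define c where "c J = (\<Sum>K | K \<subseteq> J. (-1) ^ card (J - K) * g K)" for J
  have expand: "g I = (\<Sum>J\<in>Pow V. c J * of_bool (J \<subseteq> I))" if "I \<subseteq> V" for I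
    unfolding c_def by (rule mobius_expansion[OF finite_V that])
  have "(\<Sum>I\<in>Pow V. F I * set_generator 0 1 g I)
      = (\<Sum>I\<in>Pow V. F I * set_generator 0 1 (\<lambda>I. \<Sum>J\<in>Pow V. c J * of_bool (J \<subseteq> I)) I)"
    by (intro sum.cong refl arg_cong2[where f="(*)"] set_generator_cong expand) auto
  also have "\<dots> = (\<Sum>J\<in>Pow V. c J * (\<Sum>I\<in>Pow V. F I * set_generator 0 1 (\<lambda>I. of_bool (J \<subseteq> I)) I))"
    unfolding set_generator_sum sum_distrib_left
    by (subst sum.swap) (simp add: mult_ac)
  also have "\<dots> = 0" using basis by simp
  finally show ?thesis .
qed

text \<open>
  Maximum principle: at a positive maximum each term of the generator, the killing included, is
  nonpositive and hence 0. So the family where it is attained is closed under exchanges and under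
  removal at \<open>N - 1\<close>, hence contains the empty set, where \<open>d\<close> is 0.
\<close>

lemma killed_harmonic_le:
  assumes d: "\<And>B. B \<subseteq> V \<Longrightarrow> card B \<le> k \<Longrightarrow> killed_generator d B = 0" and d0: "d {} = 0"
    and B: "B \<subseteq> V" "card B \<le> k"
  shows "d B \<le> 0"
proof -
  define \<F> where "\<F> = {B. B \<subseteq> V \<and> card B \<le> k}"
  have fin: "finite \<F>" by (rule finite_subset[of _ "Pow V"]) (auto simp: \<F>_def)
  have ne: "\<F> \<noteq> {}" using B by (auto simp: \<F>_def)
  define M where "M = Max (d ` \<F>)"
  have le_M: "d C \<le> M" if "C \<in> \<F>" for C using that fin by (simp add: M_def)
  show ?thesis
  proof (rule ccontr)
    assume "\<not> d B \<le> 0"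
    then have M_pos: "M > 0" using le_M[of B] B by (auto simp: \<F>_def)
    define A where "A = {C \<in> \<F>. d C = M}"
    have "M \<in> d ` \<F>" unfolding M_def using fin ne by (intro Max_in) auto
    then have A_ne: "A \<noteq> {}" by (auto simp: A_def)
    have stir_F: "site_swap x y ` C \<in> \<F>" if "(x, y) \<in> oriented_edges" "C \<in> \<F>" for x y C
      using that transpose_image_V[OF that(1)] by (auto simp: \<F>_def card_image)
    have remove_F: "C - {z} \<in> \<F>" if "C \<in> \<F>" for z C
      using that card_mono[of C "C - {z}"] finite_subset[of C V] by (auto simp: \<F>_def)
    have step: "(\<forall>(x, y)\<in>oriented_edges. site_swap x y ` C \<in> A) \<and> C - {N - 1} \<in> A" if C: "C \<in> A" for C
    proof -
      have CF: "C \<in> \<F>" and dC: "d C = M" using C by (auto simp: A_def)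
      have terms: "w x y * (d (site_swap x y ` C) - d C) \<le> 0" if "(x, y) \<in> oriented_edges" for x y
        using le_M[OF stir_F[OF that CF]] oriented_edgesD(5)[OF that] dC by (simp add: mult_le_0_iff)
      then have "stirring_generator d C \<le> 0"
        unfolding stirring_generator_def by (intro sum_nonpos) auto
      moreover have "\<omega>L * (if 1 \<in> C then d C else 0) \<ge> 0" using dC M_pos \<omega>L_pos by auto
      moreover have "\<omega>R * (d (C - {N - 1}) - d C) \<le> 0"
        using le_M[OF remove_F[OF CF]] \<omega>R_pos dC by (simp add: mult_le_0_iff)
      moreover have "killed_generator d C = 0" using d CF by (auto simp: \<F>_def)
      ultimately have z: "stirring_generator d C = 0" "\<omega>R * (d (C - {N - 1}) - d C) = 0"
        unfolding killed_generator_def by linarith+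
      have "\<forall>e\<in>oriented_edges. (case e of (x, y) \<Rightarrow> - (w x y * (d (site_swap x y ` C) - d C))) = 0"
        by (subst sum_nonneg_eq_0_iff[symmetric])
          (use z(1) terms in \<open>auto simp: stirring_generator_def case_prod_unfold sum_negf\<close>)
      then have "\<forall>(x, y)\<in>oriented_edges. d (site_swap x y ` C) = M"
        using dC by (fastforce dest: oriented_edgesD(5))
      then show ?thesis
        using z(2) \<omega>R_pos dC stir_F CF remove_F by (auto simp: A_def)
    qed
    have "{} \<in> A"
    proof (rule empty_in_closed_family[OF _ A_ne sites_in_V(2)])
      show "A \<subseteq> Pow V" by (auto simp: A_def \<F>_def)
    qed (use step in blast)+
    then show False using d0 M_pos by (auto simp: A_def)
  qed
qed

lemma killed_harmonic_unique:
  assumes g: "\<And>B. B \<subseteq> V \<Longrightarrow> card B \<le> k \<Longrightarrow> killed_generator g B = 0"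
    and g': "\<And>B. B \<subseteq> V \<Longrightarrow> card B \<le> k \<Longrightarrow> killed_generator g' B = 0"
    and "g {} = g' {}" "B \<subseteq> V" "card B \<le> k"
  shows "g B = g' B"
proof -
  have diff: "killed_generator (\<lambda>B. f B - f' B) C = killed_generator f C - killed_generator f' C" for f f' C
    using killed_generator_sum[of "\<lambda>b. if b then 1 else -1" "\<lambda>b. if b then f else f'" "UNIV :: bool set" C]
    by (simp add: UNIV_bool)
  have "g B - g' B \<le> 0"
    by (rule killed_harmonic_le[of k "\<lambda>B. g B - g' B"]) (use assms in \<open>auto simp: diff\<close>)
  moreover have "g' B - g B \<le> 0"
    by (rule killed_harmonic_le[of k "\<lambda>B. g' B - g B"]) (use assms in \<open>auto simp: diff\<close>)
  ultimately show ?thesis by simp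
qed

section \<open>Occupation numbers and product measures\<close>

text \<open>
  Bulk occupation given by \<open>B\<close>, with values \<open>c\<close> elsewhere. This covers configurations of both the
  exclusion process (\<open>c = 0\<close>) and its dual (\<open>c\<close> records absorbed particles).
\<close>

definition with_bulk :: "(nat \<Rightarrow> nat) \<Rightarrow> nat set \<Rightarrow> nat \<Rightarrow> nat" where
  "with_bulk c B = (\<lambda>x. if x \<in> V then of_bool (x \<in> B) else c x)"

lemma ind_eq_with_bulk: "B \<subseteq> V \<Longrightarrow> ind B = with_bulk (\<lambda>_. 0) B"
  by (auto simp: ind_def with_bulk_def fun_eq_iff)

lemma sep_configs_eq: "sep_configs N = ind ` Pow V"
proof (intro subset_antisym subsetI)
  fix \<eta> assume \<eta>: "\<eta> \<in> sep_configs N"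
  then have "\<eta> x = 0 \<or> \<eta> x = 1" and "x \<notin> V \<Longrightarrow> \<eta> x = 0" for x
    unfolding sep_configs_def PiE_dflt_def V_def by blast+
  then have "\<eta> = ind {x. \<eta> x = 1}" "{x. \<eta> x = 1} \<subseteq> V"
    by (force simp: ind_def fun_eq_iff)+
  then show "\<eta> \<in> ind ` Pow V" by blast
qed (auto simp: sep_configs_def PiE_dflt_def ind_def V_def)

lemma finite_sep_configs: "finite (sep_configs N)"
  by (simp add: sep_configs_eq)

lemma sum_sep_configs: "(\<Sum>\<eta>\<in>sep_configs N. f \<eta>) = (\<Sum>I\<in>Pow V. f (ind I))"
  unfolding sep_configs_eq by (subst sum.reindex) (auto simp: inj_on_ind)

lemma move_with_bulk:
  assumes "x \<in> V" "y \<in> V" "x \<in> B" "y \<notin> B"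
  shows "move (with_bulk c B) x y = with_bulk c (site_swap x y ` B)"
  using assms by (auto simp: move_def with_bulk_def fun_eq_iff mem_site_swap_image Transposition.transpose_def)

lemma bulk_generator_with_bulk:
  "bulk_generator E w f (with_bulk c B) = stirring_generator (\<lambda>B. f (with_bulk c B)) B"
  unfolding bulk_generator_def stirring_generator_def
proof (rule sum.cong)
  show "{(x, y). x < y \<and> {x, y} \<in> E} = oriented_edges" by (simp add: oriented_edges_def)
  fix e assume "e \<in> oriented_edges"
  then obtain x y where e: "e = (x, y)" "(x, y) \<in> oriented_edges" by (cases e) auto
  note V = oriented_edgesD[OF e(2)]
  let ?\<xi> = "with_bulk c B"
  have at: "?\<xi> x = of_bool (x \<in> B)" "?\<xi> y = of_bool (y \<in> B)"
    using V by (auto simp: with_bulk_def)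
  have "real (?\<xi> x) * (1 - real (?\<xi> y)) * (f (move ?\<xi> x y) - f ?\<xi>)
       + real (?\<xi> y) * (1 - real (?\<xi> x)) * (f (move ?\<xi> y x) - f ?\<xi>)
       = f (with_bulk c (site_swap x y ` B)) - f ?\<xi>"
  proof (cases "x \<in> B \<longleftrightarrow> y \<in> B")
    case True
    then have "site_swap x y ` B = B" by (auto simp: mem_site_swap_image Transposition.transpose_def)
    then show ?thesis using True by (simp add: at)
  next
    case False
    then consider "x \<in> B" "y \<notin> B" | "y \<in> B" "x \<notin> B" by blast
    then show ?thesis
    proof cases
      case 1
      then show ?thesis using move_with_bulk[OF V(1,2) 1] by (simp add: at)
    next
      case 2
      then show ?thesis
        using move_with_bulk[OF V(2,1) 2] by (simp add: at Transposition.transpose_commute[of y x])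
    qed
  qed
  then show "(case e of (x, y) \<Rightarrow> w x y *
        (real (?\<xi> x) * (1 - real (?\<xi> y)) * (f (move ?\<xi> x y) - f ?\<xi>)
       + real (?\<xi> y) * (1 - real (?\<xi> x)) * (f (move ?\<xi> y x) - f ?\<xi>)))
     = (case e of (x, y) \<Rightarrow> w x y * (f (with_bulk c (site_swap x y ` B)) - f ?\<xi>))"
    by (simp add: e)
qed

lemma reservoir_generator_ind:
  "reservoir_generator \<rho> x f (ind I)
     = (1 - \<rho>) * (f (ind (I - {x})) - f (ind I)) + \<rho> * (f (ind (insert x I)) - f (ind I))"
proof -
  have "(ind I)(x := 0) = ind (I - {x})" "(ind I)(x := 1) = ind (insert x I)"
    by (auto simp: ind_def)
  moreover have "I - {x} = I" if "x \<notin> I" using that by simp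
  moreover have "insert x I = I" if "x \<in> I" using that by blast
  ultimately show ?thesis
    unfolding reservoir_generator_def by (cases "x \<in> I") (simp_all add: ind_def[of I])
qed

lemma sep_generator_ind:
  assumes "I \<subseteq> V"
  shows "sep_generator N E w \<omega>L \<omega>R a b f (ind I) = set_generator a b (\<lambda>I. f (ind I)) I"
proof -
  have "stirring_generator (\<lambda>B. f (with_bulk (\<lambda>_. 0) B)) I = stirring_generator (\<lambda>I. f (ind I)) I"
    unfolding stirring_generator_def
    using assms transpose_image_V by (intro sum.cong refl) (auto simp: ind_eq_with_bulk case_prod_unfold)
  then show ?thesis
    unfolding sep_generator_def set_generator_def reservoir_generator_ind
    using bulk_generator_with_bulk[of f "\<lambda>_. 0" I] assms by (simp add: ind_eq_with_bulk)
qed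

text \<open>
  Each exchange along an edge, and each insertion or removal by a reservoir, is a deterministic
  map applied at a constant rate.
\<close>

lemma jump_generator_sep:
  assumes ab: "0 \<le> a" "a \<le> 1" "0 \<le> b" "b \<le> 1"
  shows "jump_generator (sep_configs N) (sep_generator N E w \<omega>L \<omega>R a b)"
proof -
  let ?S = "sep_configs N"
  let ?J = "\<lambda>r (\<phi> :: nat set \<Rightarrow> nat set) f \<eta>. r * (f (ind (\<phi> {x. \<eta> x = 1})) - f \<eta>)"
  have kernel: "jump_generator ?S (?J r \<phi>)" if "r \<ge> 0" "\<And>I. I \<subseteq> V \<Longrightarrow> \<phi> I \<subseteq> V" for r \<phi>
    using that by (intro jump_generator_kernel[where c=r and K = "\<lambda>\<eta>. return_pmf (ind (\<phi> {x. \<eta> x = 1}))"])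
      (auto simp: sep_configs_eq)
  let ?L = "\<lambda>f \<eta>. (\<Sum>e\<in>oriented_edges. ?J (w (fst e) (snd e)) (\<lambda>I. site_swap (fst e) (snd e) ` I) f \<eta>)
     + (?J (\<omega>L * (1 - a)) (\<lambda>I. I - {1}) f \<eta> + ?J (\<omega>L * a) (insert 1) f \<eta>
     + (?J (\<omega>R * (1 - b)) (\<lambda>I. I - {N - 1}) f \<eta> + ?J (\<omega>R * b) (insert (N - 1)) f \<eta>))"
  have stir: "jump_generator ?S
      (\<lambda>f \<eta>. \<Sum>e\<in>oriented_edges. ?J (w (fst e) (snd e)) (\<lambda>I. site_swap (fst e) (snd e) ` I) f \<eta>)"
  proof (rule jump_generator_sum[OF finite_sep_configs finite_oriented_edges])
    fix e assume "e \<in> oriented_edges"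
    then have e: "(fst e, snd e) \<in> oriented_edges" by simp
    show "jump_generator ?S (?J (w (fst e) (snd e)) (\<lambda>I. site_swap (fst e) (snd e) ` I))"
      using oriented_edgesD(5)[OF e] by (intro kernel transpose_image_V[OF e]) auto
  qed
  have left: "jump_generator ?S (?J (\<omega>L * (1 - a)) (\<lambda>I. I - {1}))"
      "jump_generator ?S (?J (\<omega>L * a) (insert 1))"
    using ab \<omega>L_pos sites_in_V by (intro kernel; auto)+
  have right: "jump_generator ?S (?J (\<omega>R * (1 - b)) (\<lambda>I. I - {N - 1}))"
      "jump_generator ?S (?J (\<omega>R * b) (insert (N - 1)))"
    using ab \<omega>R_pos sites_in_V by (intro kernel; auto)+
  note add = jump_generator_add[OF finite_sep_configs]
  have "jump_generator ?S ?L"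
    by (rule add[OF stir add[OF add[OF left] add[OF right]]])
  then show ?thesis
  proof (rule jump_generator_cong)
    fix \<eta> f assume "\<eta> \<in> ?S"
    then obtain I where I: "I \<subseteq> V" "\<eta> = ind I" by (auto simp: sep_configs_eq)
    show "sep_generator N E w \<omega>L \<omega>R a b f \<eta> = ?L f \<eta>"
      unfolding I(2) support_ind sep_generator_ind[OF I(1)] set_generator_def stirring_generator_def
        case_prod_unfold by (simp only: distrib_left mult.assoc add.assoc)
  qed
qed

definition product_weight :: "real \<Rightarrow> real \<Rightarrow> nat set \<Rightarrow> nat set \<Rightarrow> real" where
  "product_weight a b I K =
     (\<Prod>x\<in>V. if x \<in> K then (if x \<in> I then b else a) else 1 - (if x \<in> I then b else a))"

lemma pmf_bernoulli_product:
  assumes "0 \<le> a" "a \<le> 1" "0 \<le> b" "b \<le> 1" "K \<subseteq> V"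
  shows "pmf (bernoulli_product N a b I) (ind K) = product_weight a b I K"
proof -
  have "pmf (map_pmf of_bool (bernoulli_pmf q)) (if x \<in> K then 1 else 0 :: nat)
      = (if x \<in> K then q else 1 - q)" if "0 \<le> q" "q \<le> 1" for q x
  proof -
    have "(of_bool -` {1 :: nat}) = {True}" "(of_bool -` {0 :: nat}) = {False}"
      by (auto simp: of_bool_def split: if_splits)
    then show ?thesis using that by (simp add: pmf_map measure_pmf_single)
  qed
  then show ?thesis
    unfolding bernoulli_product_def product_weight_def V_def[symmetric]
    using assms by (subst pmf_Pi') (auto simp: ind_def intro!: prod.cong)
qed

lemma set_bernoulli_product: "set_pmf (bernoulli_product N a b I) \<subseteq> sep_configs N"
proof
  fix \<eta> assume "\<eta> \<in> set_pmf (bernoulli_product N a b I)"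
  then have "\<eta> \<in> PiE_dflt {1..N - 1} 0
      (\<lambda>x. set_pmf (map_pmf of_bool (bernoulli_pmf (if x \<in> I then b else a))))"
    using set_Pi_pmf_subset'[of "{1..N - 1}" "0 :: nat"]
    unfolding bernoulli_product_def o_def by blast
  moreover have "set_pmf (map_pmf of_bool p) \<subseteq> {0, 1 :: nat}" for p
    by (auto simp: of_bool_def split: if_splits)
  ultimately show "\<eta> \<in> sep_configs N"
    unfolding sep_configs_def PiE_dflt_def by blast
qed

lemma product_weight_swap:
  assumes "(x, y) \<in> oriented_edges"
  shows "product_weight a b (site_swap x y ` I) (site_swap x y ` K) = product_weight a b I K"
proof -
  have "site_swap x y z \<in> V" if "z \<in> V" for z
    using that oriented_edgesD(1,2)[OF assms] by (simp add: Transposition.transpose_def)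
  then show ?thesis
    unfolding product_weight_def
    by (intro prod.reindex_bij_witness[of _ "site_swap x y" "site_swap x y"])
      (simp_all add: mem_site_swap_image)
qed

lemma sum_Pow_split:
  assumes "z \<in> V"
  shows "(\<Sum>K\<in>Pow V. \<phi> K) = (\<Sum>K\<in>Pow (V - {z}). \<phi> K + (\<phi> (insert z K) :: real))"
proof -
  have "Pow V = Pow (V - {z}) \<union> insert z ` Pow (V - {z})"
    using assms Pow_insert[of z "V - {z}"] by (simp add: insert_absorb)
  then have "(\<Sum>K\<in>Pow V. \<phi> K) = (\<Sum>K\<in>Pow (V - {z}). \<phi> K) + (\<Sum>K\<in>insert z ` Pow (V - {z}). \<phi> K)"
    by (simp only:) (rule sum.union_disjoint, auto)
  also have "(\<Sum>K\<in>insert z ` Pow (V - {z}). \<phi> K) = (\<Sum>K\<in>Pow (V - {z}). \<phi> (insert z K))"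
    by (subst sum.reindex) (auto simp: inj_on_def)
  finally show ?thesis by (simp add: sum.distrib)
qed

text \<open>
  Both sides sum out the content of site \<open>z\<close>: replacing it by a fresh Bernoulli variable gives the
  product law in which the parameter at \<open>z\<close> is \<open>r\<close>.
\<close>

lemma product_weight_resample:
  assumes z: "z \<in> V" and r: "r = (if z \<in> I' then b else a)" and I: "I - {z} = I' - {z}"
  shows "(\<Sum>K\<in>Pow V. product_weight a b I K * ((1 - r) * g (K - {z}) + r * g (insert z K)))
       = (\<Sum>K\<in>Pow V. product_weight a b I' K * g K)"
proof -
  define w0 where "w0 I K = (\<Prod>x\<in>V - {z}. if x \<in> K then (if x \<in> I then b else a) else 1 - (if x \<in> I then b else a))" for I K
  have same: "w0 I K = w0 I' K" for K
    unfolding w0_def using I by (intro prod.cong refl) auto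
  have absent: "product_weight a b I K = (1 - (if z \<in> I then b else a)) * w0 I K"
    and present: "product_weight a b I (insert z K) = (if z \<in> I then b else a) * w0 I K"
    if "K \<in> Pow (V - {z})" for I K
  proof -
    show "product_weight a b I K = (1 - (if z \<in> I then b else a)) * w0 I K"
      unfolding product_weight_def w0_def using that by (subst prod.remove[OF finite_V z]) auto
    have "(\<Prod>x\<in>V - {z}. if x \<in> insert z K then (if x \<in> I then b else a) else 1 - (if x \<in> I then b else a)) = w0 I K"
      unfolding w0_def by (intro prod.cong refl) auto
    then show "product_weight a b I (insert z K) = (if z \<in> I then b else a) * w0 I K"
      unfolding product_weight_def by (subst prod.remove[OF finite_V z]) auto
  qed
  show ?thesis
    unfolding sum_Pow_split[OF z]
  proof (rule sum.cong)
    fix K assume K: "K \<in> Pow (V - {z})"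
    then have "K - {z} = K" "insert z K - {z} = K" by auto
    then show "product_weight a b I K * ((1 - r) * g (K - {z}) + r * g (insert z K))
        + product_weight a b I (insert z K) * ((1 - r) * g (insert z K - {z}) + r * g (insert z (insert z K)))
        = product_weight a b I' K * g K + product_weight a b I' (insert z K) * g (insert z K)"
      unfolding absent[OF K] present[OF K] same r by (simp add: algebra_simps)
  qed simp
qed

text \<open>
  Exchanges permute the factors of the product law. The left reservoir resamples site 1 with
  parameter \<open>a\<close>, which is what colouring does once 1 is removed from \<open>I\<close>; likewise the right
  reservoir with parameter \<open>b\<close> and the insertion of \<open>N - 1\<close>.
\<close>

lemma set_generator_intertwining:
  assumes "I \<subseteq> V"
  shows "(\<Sum>K\<in>Pow V. product_weight a b I K * set_generator a b g K)
       = set_generator 0 1 (\<lambda>I. \<Sum>K\<in>Pow V. product_weight a b I K * g K) I"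
proof -
  let ?T = "\<lambda>g I. \<Sum>K\<in>Pow V. product_weight a b I K * g K"
  have swap: "?T (\<lambda>K. g (site_swap x y ` K)) I = ?T g (site_swap x y ` I)"
    if e: "(x, y) \<in> oriented_edges" for x y
    by (rule sum.reindex_bij_witness[of _ "\<lambda>K. site_swap x y ` K" "\<lambda>K. site_swap x y ` K"])
      (use transpose_image_V[OF e] product_weight_swap[OF e] in \<open>auto simp: image_image\<close>)
  have "(\<Sum>K\<in>Pow V. product_weight a b I K * stirring_generator g K)
      = (\<Sum>e\<in>oriented_edges. w (fst e) (snd e) * (?T (\<lambda>K. g (site_swap (fst e) (snd e) ` K)) I - ?T g I))"
    unfolding stirring_generator_def case_prod_unfold sum_distrib_left
    by (subst sum.swap, intro sum.cong refl)
      (simp add: sum_distrib_left sum_subtractf[symmetric] algebra_simps)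
  also have "\<dots> = stirring_generator (?T g) I"
    unfolding stirring_generator_def case_prod_unfold
    by (intro sum.cong refl) (simp add: swap)
  finally have stir: "(\<Sum>K\<in>Pow V. product_weight a b I K * stirring_generator g K) = stirring_generator (?T g) I" .
  have res: "(\<Sum>K\<in>Pow V. product_weight a b I K * ((1 - r) * (g (K - {z}) - g K) + r * (g (insert z K) - g K)))
      = ?T g I' - ?T g I"
    if "z \<in> V" "r = (if z \<in> I' then b else a)" "I - {z} = I' - {z}" for z r I'
  proof -
    have "(\<Sum>K\<in>Pow V. product_weight a b I K * ((1 - r) * (g (K - {z}) - g K) + r * (g (insert z K) - g K)))
        = (\<Sum>K\<in>Pow V. product_weight a b I K * ((1 - r) * g (K - {z}) + r * g (insert z K))) - ?T g I"
      unfolding sum_subtractf[symmetric] by (intro sum.cong refl) (simp add: algebra_simps)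
    then show ?thesis using product_weight_resample[OF that] by simp
  qed
  have "(\<Sum>K\<in>Pow V. product_weight a b I K * set_generator a b g K)
     = (\<Sum>K\<in>Pow V. product_weight a b I K * stirring_generator g K)
     + \<omega>L * (\<Sum>K\<in>Pow V. product_weight a b I K * ((1 - a) * (g (K - {1}) - g K) + a * (g (insert 1 K) - g K)))
     + \<omega>R * (\<Sum>K\<in>Pow V. product_weight a b I K * ((1 - b) * (g (K - {N - 1}) - g K) + b * (g (insert (N - 1) K) - g K)))"
    unfolding set_generator_def sum_distrib_left sum.distrib[symmetric]
    by (intro sum.cong refl) (simp add: algebra_simps)
  also have "\<dots> = set_generator 0 1 (?T g) I"
    unfolding stir set_generator_def
    using res[OF sites_in_V(1), of a "I - {1}"] res[OF sites_in_V(2), of b "insert (N - 1) I"] by simp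
  finally show ?thesis .
qed

lemma product_mixture_invariant:
  assumes "\<And>g. (\<Sum>I\<in>Pow V. F I * set_generator 0 1 g I) = 0"
  shows "(\<Sum>K\<in>Pow V. (\<Sum>I\<in>Pow V. F I * product_weight a b I K) * set_generator a b g K) = 0"
proof -
  have "(\<Sum>K\<in>Pow V. (\<Sum>I\<in>Pow V. F I * product_weight a b I K) * set_generator a b g K)
      = (\<Sum>I\<in>Pow V. F I * (\<Sum>K\<in>Pow V. product_weight a b I K * set_generator a b g K))"
    unfolding sum_distrib_left sum_distrib_right by (subst sum.swap) (simp add: mult_ac)
  also have "\<dots> = (\<Sum>I\<in>Pow V. F I * set_generator 0 1 (\<lambda>I. \<Sum>K\<in>Pow V. product_weight a b I K * g K) I)"
    by (intro sum.cong refl) (simp add: set_generator_intertwining)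
  finally show ?thesis using assms by simp
qed

section \<open>Absorption probabilities of the dual process\<close>

text \<open>
  The dual configurations with \<open>k\<close> particles in total, absorbed ones included. The generator
  preserves this finite set.
\<close>

definition dual_level :: "nat \<Rightarrow> (nat \<Rightarrow> nat) set" where
  "dual_level k = {\<xi> \<in> dual_configs N. (\<Sum>x\<le>N. \<xi> x) = k}"

lemma dual_configs_iff:
  "\<xi> \<in> dual_configs N \<longleftrightarrow> (\<forall>x\<in>V. \<xi> x \<le> 1) \<and> (\<forall>x>N. \<xi> x = 0)"
  unfolding dual_configs_def PiE_dflt_def V_def
  by (auto simp: le_Suc_eq all_conj_distrib)

lemma dual_level_le: "\<xi> \<in> dual_level k \<Longrightarrow> \<xi> x \<le> k"
proof (cases "x \<le> N")
  case True
  assume "\<xi> \<in> dual_level k"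
  then show ?thesis using True member_le_sum[of x "{..N}" \<xi>] by (auto simp: dual_level_def)
qed (auto simp: dual_level_def dual_configs_iff)

lemma finite_dual_level: "finite (dual_level k)"
proof (rule finite_subset)
  show "dual_level k \<subseteq> PiE_dflt {..N} 0 (\<lambda>_. {..k})"
    using dual_level_le[of _ k] by (auto simp: PiE_dflt_def dual_level_def dual_configs_iff)
qed (intro finite_PiE_dflt; simp)

lemma move_in_dual_level:
  assumes \<xi>: "\<xi> \<in> dual_level k" and "x \<le> N" "y \<le> N" "x \<noteq> y" "\<xi> x \<ge> 1" "y \<in> V \<Longrightarrow> \<xi> y = 0"
  shows "move \<xi> x y \<in> dual_level k"
proof -
  have "(\<Sum>z\<le>N. move \<xi> x y z) + \<xi> x + \<xi> y = (\<Sum>z\<in>{..N} - {x} - {y}. \<xi> z) + (\<xi> x - 1) + (\<xi> y + 1) + \<xi> x + \<xi> y"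
    using assms by (subst sum.remove[of _ x], simp, simp, subst sum.remove[of _ y])
      (auto simp: move_def intro!: sum.cong)
  moreover have "(\<Sum>z\<le>N. \<xi> z) = (\<Sum>z\<in>{..N} - {x} - {y}. \<xi> z) + \<xi> x + \<xi> y"
    using assms by (subst sum.remove[of _ x], simp, simp, subst sum.remove[of _ y]) auto
  ultimately have "(\<Sum>z\<le>N. move \<xi> x y z) = (\<Sum>z\<le>N. \<xi> z)"
    using assms(5) by simp
  moreover have "move \<xi> x y \<in> dual_configs N"
    using assms by (auto simp: dual_level_def dual_configs_iff move_def)
  ultimately show ?thesis using \<xi> by (simp add: dual_level_def)
qed

lemma dual_generator_closed:
  assumes X: "\<xi> \<in> X" "X \<subseteq> dual_configs N"
    and closed: "\<And>x y. x \<in> V \<Longrightarrow> y \<le> N \<Longrightarrow> x \<noteq> y \<Longrightarrow> \<xi> x = 1 \<Longrightarrow> (y \<in> V \<Longrightarrow> \<xi> y = 0)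
      \<Longrightarrow> move \<xi> x y \<in> X"
  shows "dual_generator N E w \<omega>L \<omega>R (indicator X) \<xi> = 0"
proof -
  have le: "\<xi> x = 0 \<or> \<xi> x = 1" if "x \<in> V" for x
    using that X le_Suc_eq by (fastforce simp: dual_configs_iff)
  have V_le: "x \<in> V \<Longrightarrow> x \<le> N" for x by (auto simp: V_def)
  have bulk: "bulk_generator E w (indicator X) \<xi> = 0"
    unfolding bulk_generator_def
  proof (rule sum.neutral, clarify)
    fix x y assume "x < y" "{x, y} \<in> E"
    then have V: "x \<in> V" "y \<in> V" "x \<noteq> y" using oriented_edgesD[of x y] by (auto simp: oriented_edges_def)
    show "w x y *
       (real (\<xi> x) * (1 - real (\<xi> y)) * (indicator X (move \<xi> x y) - indicator X \<xi>) +
        real (\<xi> y) * (1 - real (\<xi> x)) * (indicator X (move \<xi> y x) - indicator X \<xi>)) = 0"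
      using le[OF V(1)] le[OF V(2)] closed[of x y] closed[of y x] V V_le X(1) by auto
  qed
  have left: "real (\<xi> 1) * (indicator X (move \<xi> 1 0) - indicator X \<xi>) = (0 :: real)"
    using le[of 1] closed[of 1 0] sites_in_V X(1) by auto
  have right: "real (\<xi> (N - 1)) * (indicator X (move \<xi> (N - 1) N) - indicator X \<xi>) = (0 :: real)"
    using le[of "N - 1"] closed[of "N - 1" N] sites_in_V N_ge_2 X(1) by auto
  show ?thesis unfolding dual_generator_def mult.assoc bulk left right by simp
qed

lemma dual_level_at_least_N_closed:
  assumes "\<xi> \<in> {\<xi> \<in> dual_level k. m \<le> \<xi> N}"
  shows "dual_generator N E w \<omega>L \<omega>R (indicator {\<xi> \<in> dual_level k. m \<le> \<xi> N}) \<xi> = 0"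
proof (rule dual_generator_closed[OF assms])
  fix x y assume xy: "x \<in> V" "y \<le> N" "x \<noteq> y" "\<xi> x = 1" "y \<in> V \<Longrightarrow> \<xi> y = 0"
  then have "x \<le> N" "x \<noteq> N" using N_ge_2 by (auto simp: V_def)
  then show "move \<xi> x y \<in> {\<xi> \<in> dual_level k. m \<le> \<xi> N}"
    using move_in_dual_level[of \<xi> k x y] xy assms by (auto simp: move_def)
qed (auto simp: dual_level_def)

lemma dual_level_lost_closed:
  assumes "\<xi> \<in> {\<xi> \<in> dual_level k. 1 \<le> \<xi> 0}"
  shows "dual_generator N E w \<omega>L \<omega>R (indicator {\<xi> \<in> dual_level k. 1 \<le> \<xi> 0}) \<xi> = 0"
proof (rule dual_generator_closed[OF assms])
  fix x y assume xy: "x \<in> V" "y \<le> N" "x \<noteq> y" "\<xi> x = 1" "y \<in> V \<Longrightarrow> \<xi> y = 0"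
  then have "x \<le> N" "x \<noteq> 0" using N_ge_2 by (auto simp: V_def)
  then show "move \<xi> x y \<in> {\<xi> \<in> dual_level k. 1 \<le> \<xi> 0}"
    using move_in_dual_level[of \<xi> k x y] xy assms by (auto simp: move_def)
qed (auto simp: dual_level_def)

text \<open>
  The dual configuration with \<open>k\<close> particles of which those in \<open>B\<close> are still in the bulk and all
  others have been absorbed at \<open>N\<close>.
\<close>

definition dual_state :: "nat \<Rightarrow> nat set \<Rightarrow> nat \<Rightarrow> nat" where
  "dual_state k B = with_bulk (\<lambda>x. if x = N then k - card B else 0) B"

lemma dual_state_in_level:
  assumes "B \<subseteq> V" "card B \<le> k"
  shows "dual_state k B \<in> dual_level k"
proof -
  have split: "{..N} = insert 0 (insert N V)" using N_ge_2 by (auto simp: V_def)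
  have "(\<Sum>x\<in>V. dual_state k B x) = (\<Sum>x\<in>V. of_bool (x \<in> B))"
    by (intro sum.cong refl) (simp add: dual_state_def with_bulk_def)
  also have "\<dots> = card B" using assms(1) by (simp add: Int_absorb1)
  finally have "(\<Sum>x\<le>N. dual_state k B x) = k"
    using assms(2) sites_in_V N_ge_2 unfolding split by (simp add: dual_state_def with_bulk_def)
  moreover have "dual_state k B \<in> dual_configs N"
    using sites_in_V by (auto simp: dual_configs_iff dual_state_def with_bulk_def V_def)
  ultimately show ?thesis by (simp add: dual_level_def)
qed

text \<open>
  A jump to 0 leads to a state where \<open>v\<close> vanishes, which is the killing; a jump from \<open>N - 1\<close> to
  \<open>N\<close> removes \<open>N - 1\<close> from \<open>B\<close> and is recorded by \<open>k - card B\<close>.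
\<close>

lemma harmonic_restricts_to_killed_harmonic:
  assumes v: "\<And>\<xi>. \<xi> \<in> dual_level k \<Longrightarrow> dual_generator N E w \<omega>L \<omega>R v \<xi> = 0"
    and lost: "\<And>\<xi>. \<xi> \<in> dual_level k \<Longrightarrow> 1 \<le> \<xi> 0 \<Longrightarrow> v \<xi> = 0"
    and B: "B \<subseteq> V" "card B \<le> k"
  shows "killed_generator (\<lambda>B. v (dual_state k B)) B = 0"
proof -
  let ?c = "\<lambda>x. if x = N then k - card B else 0"
  let ?\<xi> = "dual_state k B"
  have lev: "?\<xi> \<in> dual_level k" by (rule dual_state_in_level[OF B])
  have at: "?\<xi> x = of_bool (x \<in> B)" if "x \<in> V" for x using that by (simp add: dual_state_def with_bulk_def)
  have bulk: "bulk_generator E w v ?\<xi> = stirring_generator (\<lambda>B. v (dual_state k B)) B"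
    unfolding dual_state_def bulk_generator_with_bulk
    unfolding stirring_generator_def by (intro sum.cong refl) (auto simp: card_site_swap_image cong: if_cong)
  have left: "real (?\<xi> 1) * (v (move ?\<xi> 1 0) - v ?\<xi>) = - (if 1 \<in> B then v ?\<xi> else 0)"
  proof (cases "1 \<in> B")
    case True
    have "move ?\<xi> 1 0 \<in> dual_level k"
      using at[OF sites_in_V(1)] True sites_in_V N_ge_2 by (intro move_in_dual_level[OF lev]) auto
    then have "v (move ?\<xi> 1 0) = 0" by (rule lost) (simp add: move_def)
    then show ?thesis using True at[OF sites_in_V(1)] by simp
  next
    case False
    then show ?thesis using at[OF sites_in_V(1)] by simp
  qed
  have right: "real (?\<xi> (N - 1)) * (v (move ?\<xi> (N - 1) N) - v ?\<xi>)
      = v (dual_state k (B - {N - 1})) - v ?\<xi>"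
  proof (cases "N - 1 \<in> B")
    case True
    have "finite B" using B(1) finite_subset finite_V by blast
    then have "card (B - {N - 1}) + 1 = card B" using True by (metis Suc_eq_plus1 card_Suc_Diff1)
    then have "move ?\<xi> (N - 1) N = dual_state k (B - {N - 1})"
      using True B sites_in_V N_ge_2 by (auto simp: move_def dual_state_def with_bulk_def fun_eq_iff)
    then show ?thesis using True at[OF sites_in_V(2)] by simp
  next
    case False
    then show ?thesis using at[OF sites_in_V(2)] by simp
  qed
  have "dual_generator N E w \<omega>L \<omega>R v ?\<xi> = killed_generator (\<lambda>B. v (dual_state k B)) B"
    unfolding dual_generator_def killed_generator_def bulk mult.assoc left right by simp
  then show ?thesis using v[OF lev] by simp
qed

text \<open>
  Here \<open>g B\<close> is the probability that all \<open>card J\<close> particles end at \<open>N\<close> when those in \<open>B\<close> are still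
  in the bulk and the others are already there.
\<close>

lemma absorption_probability_killed_harmonic:
  assumes mp: "markov_process (dual_configs N) (dual_generator N E w \<omega>L \<omega>R) M X"
    and J: "J \<subseteq> V" and start: "AE \<omega> in M. X 0 \<omega> = ind J"
  obtains g where "\<And>B. B \<subseteq> V \<Longrightarrow> card B \<le> card J \<Longrightarrow> killed_generator g B = 0" "g {} = 1"
    "g J = measure M {\<omega> \<in> space M. limit_state X \<omega> N = card J}"
proof -
  let ?k = "card J" let ?D = "\<lambda>m. {\<xi> \<in> dual_level ?k. m \<le> \<xi> N}"
  have sub: "dual_level ?k \<subseteq> dual_configs N" by (auto simp: dual_level_def)
  have J_state: "ind J = dual_state ?k J"
    using J by (auto simp: dual_state_def with_bulk_def ind_def fun_eq_iff)
  have J_level: "ind J \<in> dual_level ?k" unfolding J_state by (rule dual_state_in_level[OF J order_refl])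
  obtain P where sg: "markov_semigroup (dual_configs N) (dual_generator N E w \<omega>L \<omega>R) P"
    and lim: "(\<lambda>n. measure_pmf.prob (P (real n) (ind J)) (?D ?k))
       \<longlonglongrightarrow> measure M {\<omega> \<in> space M. limit_state X \<omega> N = ?k}"
  proof (rule markov_process_limit_probability[where z = N and C = "dual_level ?k" and k = ?k])
    show "markov_process (dual_configs N) (dual_generator N E w \<omega>L \<omega>R) M X" by (rule mp)
  qed (use finite_dual_level sub dual_level_le dual_level_at_least_N_closed J_level start that in auto)
  obtain v where v: "\<And>x. x \<in> dual_level ?k \<Longrightarrow> (\<lambda>n. measure_pmf.prob (P (real n) x) (?D ?k)) \<longlonglongrightarrow> v x"
    "\<And>x. x \<in> dual_level ?k \<Longrightarrow> dual_generator N E w \<omega>L \<omega>R v x = 0"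
    "\<And>x. x \<in> ?D ?k \<Longrightarrow> v x = 1"
    "\<And>x B. x \<in> B \<Longrightarrow> B \<subseteq> dual_level ?k \<Longrightarrow> B \<inter> ?D ?k = {} \<Longrightarrow>
       (\<And>x. x \<in> B \<Longrightarrow> dual_generator N E w \<omega>L \<omega>R (indicator B) x = 0) \<Longrightarrow> v x = 0"
  proof (rule markov_semigroup_absorption[where D = "?D ?k", OF sg finite_dual_level sub])
    show "dual_generator N E w \<omega>L \<omega>R (indicator (dual_level ?k)) x = 0" if "x \<in> dual_level ?k" for x
      using dual_level_at_least_N_closed[of x ?k 0] that by simp
  qed (use dual_level_at_least_N_closed in auto)
  have lost: "v \<xi> = 0" if "\<xi> \<in> dual_level ?k" "1 \<le> \<xi> 0" for \<xi>
  proof (rule v(4)[of _ "{\<xi> \<in> dual_level ?k. 1 \<le> \<xi> 0}"])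
    have "\<xi> 0 + \<xi> N \<le> ?k" if "\<xi> \<in> dual_level ?k" for \<xi>
    proof -
      have "(\<Sum>x\<in>{0, N}. \<xi> x) \<le> (\<Sum>x\<le>N. \<xi> x)" by (rule sum_mono2) auto
      then show ?thesis using that N_ge_2 by (simp add: dual_level_def)
    qed
    then show "{\<xi> \<in> dual_level ?k. 1 \<le> \<xi> 0} \<inter> ?D ?k = {}" by fastforce
  qed (use that dual_level_lost_closed in auto)
  show thesis
  proof (rule that[of "\<lambda>B. v (dual_state ?k B)"])
    show "killed_generator (\<lambda>B. v (dual_state ?k B)) B = 0" if "B \<subseteq> V" "card B \<le> ?k" for B
      using v(2) lost that by (rule harmonic_restricts_to_killed_harmonic)
    have "dual_state ?k {} \<in> dual_level ?k" by (rule dual_state_in_level) auto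
    then show "v (dual_state ?k {}) = 1"
      using sites_in_V by (intro v(3)) (simp add: dual_state_def with_bulk_def)
    show "v (dual_state ?k J) = measure M {\<omega> \<in> space M. limit_state X \<omega> N = ?k}"
      unfolding J_state[symmetric] by (rule LIMSEQ_unique[OF v(1)[OF J_level] lim])
  qed
qed

text \<open>
  The process started from the full set \<open>V\<close> yields a function \<open>g\<close> that is harmonic for sets of all
  sizes. By the maximum principle the function obtained from \<open>J\<close> agrees with \<open>g\<close> on sets of size
  at most \<open>card J\<close>, in particular at \<open>J\<close> itself; so \<open>h = g\<close>.
\<close>

lemma absorption_probabilities_killed_harmonic:
  fixes M :: "nat set \<Rightarrow> 'w measure"
  assumes mp: "\<And>J. J \<subseteq> V \<Longrightarrow> markov_process (dual_configs N) (dual_generator N E w \<omega>L \<omega>R) (M J) (\<Xi> J)"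
    and start: "\<And>J. J \<subseteq> V \<Longrightarrow> AE \<omega> in M J. \<Xi> J 0 \<omega> = ind J"
  defines "h \<equiv> \<lambda>J. measure (M J) {\<omega> \<in> space (M J). limit_state (\<Xi> J) \<omega> N = card J}"
  shows "J \<subseteq> V \<Longrightarrow> killed_generator h J = 0" and "h {} = 1"
proof -
  have ex: "\<exists>g. (\<forall>B. B \<subseteq> V \<longrightarrow> card B \<le> card J \<longrightarrow> killed_generator g B = 0) \<and> g {} = 1 \<and> g J = h J"
    if "J \<subseteq> V" for J
  proof (rule absorption_probability_killed_harmonic[OF mp[OF that] that start[OF that]])
    fix g
    assume "\<And>B. B \<subseteq> V \<Longrightarrow> card B \<le> card J \<Longrightarrow> killed_generator g B = 0" "g {} = 1"
      "g J = measure (M J) {\<omega> \<in> space (M J). limit_state (\<Xi> J) \<omega> N = card J}"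
    then show ?thesis unfolding h_def by (intro exI[of _ g]) simp
  qed
  obtain g where g_V: "\<forall>B. B \<subseteq> V \<longrightarrow> card B \<le> card V \<longrightarrow> killed_generator g B = 0" "g {} = 1"
    using ex[OF order_refl] by (elim exE conjE) (rule that)
  have g: "killed_generator g B = 0" if "B \<subseteq> V" for B
    using g_V(1) card_mono[OF finite_V that] that by simp
  have h: "h J = g J" if J: "J \<subseteq> V" for J
  proof -
    obtain g' where g': "\<forall>B. B \<subseteq> V \<longrightarrow> card B \<le> card J \<longrightarrow> killed_generator g' B = 0" "g' {} = 1" "g' J = h J"
      using ex[OF J] by (elim exE conjE) (rule that)
    have "g' J = g J"
      by (rule killed_harmonic_unique[of "card J"]) (use g g' g_V(2) J in simp_all)
    then show ?thesis using g'(3) by simp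
  qed
  show "killed_generator h J = 0" if "J \<subseteq> V"
    using killed_generator_cong[of J h g] h g that by simp
  show "h {} = 1" using h[of "{}"] g_V(2) by simp
qed

end

section \<open>The stationary distribution\<close>

theorem theorem1p1:
  fixes N :: nat
    and E :: "nat set set" and w :: "nat \<Rightarrow> nat \<Rightarrow> real"
    and \<rho>L \<rho>R \<omega>L \<omega>R :: real
    and M :: "nat set \<Rightarrow> 'w measure"
    and \<Xi> :: "nat set \<Rightarrow> real \<Rightarrow> 'w \<Rightarrow> nat \<Rightarrow> nat"
  assumes "N \<ge> 2"
    and "conductance_graph {1..N - 1} E w"
    and "0 < \<rho>L" "\<rho>L < 1" "0 < \<rho>R" "\<rho>R < 1"
    and "\<omega>L > 0" "\<omega>R > 0"
    and "\<And>J. J \<subseteq> {1..N - 1} \<Longrightarrow>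
           markov_process (dual_configs N) (dual_generator N E w \<omega>L \<omega>R) (M J) (\<Xi> J)"
    and "\<And>J. J \<subseteq> {1..N - 1} \<Longrightarrow> AE \<omega> in M J. \<Xi> J 0 \<omega> = (\<lambda>x. if x \<in> J then 1 else 0)"
  shows "(\<exists>!\<mu>. stationary_distribution (sep_configs N) (sep_generator N E w \<omega>L \<omega>R \<rho>L \<rho>R) \<mu>) \<and>
         (\<forall>\<mu>. stationary_distribution (sep_configs N) (sep_generator N E w \<omega>L \<omega>R \<rho>L \<rho>R) \<mu> \<longrightarrow>
            (\<forall>A. measure_pmf.prob \<mu> A =
               (\<Sum>I \<in> Pow {1..N - 1}.
                  mixture_weight N M \<Xi> I * measure_pmf.prob (bernoulli_product N \<rho>L \<rho>R I) A))) \<and>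
         (\<forall>I \<in> Pow {1..N - 1}. mixture_weight N M \<Xi> I > 0) \<and>
         (\<Sum>I \<in> Pow {1..N - 1}. mixture_weight N M \<Xi> I) = 1"
proof -
  interpret reservoir_graph N E w \<omega>L \<omega>R
    using assms by unfold_locales auto
  let ?stat = "stationary_distribution (sep_configs N) (sep_generator N E w \<omega>L \<omega>R \<rho>L \<rho>R)"
  define F where "F = mixture_weight N M \<Xi>"
  define h where "h J = measure (M J) {\<omega> \<in> space (M J). limit_state (\<Xi> J) \<omega> N = card J}" for J
  have F_h: "F I = (\<Sum>J | J \<subseteq> V \<and> I \<subseteq> J. (-1) ^ card (J - I) * h J)" for I
    by (simp add: F_def mixture_weight_def h_def V_def)
  have killed: "killed_generator h J = 0" if "J \<subseteq> V" for J
    unfolding h_def using assms(9,10) that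
    by (intro absorption_probabilities_killed_harmonic(1)) (auto simp: V_def ind_def)
  have h_empty: "h {} = 1"
    unfolding h_def using assms(9,10)
    by (intro absorption_probabilities_killed_harmonic(2)) (auto simp: V_def ind_def)
  have F_inv: "(\<Sum>I\<in>Pow V. F I * set_generator 0 1 g I) = 0" for g
    using killed F_h by (rule mobius_transform_invariant)
  have F_sum: "(\<Sum>I\<in>Pow V. F I) = 1"
    using sum_superset_mobius[OF finite_V, of "{}" h] h_empty by (simp add: F_h Pow_def)
  have F_pos: "\<forall>I\<in>Pow V. F I > 0"
  proof -
    have "\<exists>I\<in>Pow V. F I > 0"
    proof (rule ccontr)
      assume "\<not> ?thesis"
      then have "F I \<le> 0" if "I \<in> Pow V" for I using that not_le by blast
      then have "(\<Sum>I\<in>Pow V. F I) \<le> 0" by (rule sum_nonpos)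
      then show False using F_sum by simp
    qed
    then obtain I where "I \<subseteq> V" "F I > 0" by auto
    then show ?thesis using F_inv by (intro invariant_signed_measure_positive[of 0 1 F I]) auto
  qed
  \<comment> \<open>the mixture as a two-stage experiment: draw \<open>I\<close> with law \<open>F\<close>, then colour it\<close>
  define \<pi> where "\<pi> = embed_pmf (\<lambda>I. if I \<subseteq> V then F I else 0)"
  have pmf_\<pi>: "pmf \<pi> I = (if I \<subseteq> V then F I else 0)" for I
    unfolding \<pi>_def
  proof (rule pmf_embed_pmf)
    show "0 \<le> (if I \<subseteq> V then F I else 0)" for I using F_pos by (auto intro: less_imp_le)
    have "(\<integral>\<^sup>+ I. ennreal (if I \<subseteq> V then F I else 0) \<partial>count_space UNIV) = (\<Sum>I\<in>Pow V. ennreal (if I \<subseteq> V then F I else 0))"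
      by (rule nn_integral_count_space'[OF _ _ ]) auto
    also have "\<dots> = ennreal (\<Sum>I\<in>Pow V. F I)"
      using F_pos by (subst sum_ennreal[symmetric]) (auto intro: less_imp_le)
    finally show "(\<integral>\<^sup>+ I. ennreal (if I \<subseteq> V then F I else 0) \<partial>count_space UNIV) = 1"
      using F_sum by simp
  qed
  have set_\<pi>: "set_pmf \<pi> \<subseteq> Pow V" by (auto simp: set_pmf_iff pmf_\<pi> split: if_splits)
  define \<mu> where "\<mu> = bind_pmf \<pi> (bernoulli_product N \<rho>L \<rho>R)"
  have prob_\<mu>: "measure_pmf.prob \<mu> A = (\<Sum>I\<in>Pow V. F I * measure_pmf.prob (bernoulli_product N \<rho>L \<rho>R I) A)" for A
  proof -
    have "measure_pmf.prob \<mu> A = (\<Sum>I\<in>Pow V. measure_pmf.prob (bernoulli_product N \<rho>L \<rho>R I) A * pmf \<pi> I)"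
      unfolding \<mu>_def prob_bind_pmf using set_\<pi> by (intro integral_measure_pmf_real) auto
    then show ?thesis by (simp add: pmf_\<pi> mult.commute)
  qed
  have pmf_\<mu>: "pmf \<mu> (ind K) = (\<Sum>I\<in>Pow V. F I * product_weight \<rho>L \<rho>R I K)" if "K \<subseteq> V" for K
    using prob_\<mu>[of "{ind K}"] assms that by (simp add: measure_pmf_single pmf_bernoulli_product)
  have mean: "(\<Sum>\<eta>\<in>sep_configs N. pmf \<nu> \<eta> * sep_generator N E w \<omega>L \<omega>R \<rho>L \<rho>R f \<eta>)
      = (\<Sum>I\<in>Pow V. pmf \<nu> (ind I) * set_generator \<rho>L \<rho>R (\<lambda>I. f (ind I)) I)" for \<nu> f
    unfolding sum_sep_configs by (intro sum.cong refl) (simp add: sep_generator_ind)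
  have stat_\<mu>: "?stat \<mu>"
  proof (rule jump_generator_stationary[OF finite_sep_configs])
    show "jump_generator (sep_configs N) (sep_generator N E w \<omega>L \<omega>R \<rho>L \<rho>R)"
      using assms by (intro jump_generator_sep) auto
    show "set_pmf \<mu> \<subseteq> sep_configs N"
      unfolding \<mu>_def using set_bernoulli_product by auto
    show "(\<Sum>\<eta>\<in>sep_configs N. pmf \<mu> \<eta> * sep_generator N E w \<omega>L \<omega>R \<rho>L \<rho>R f \<eta>) = 0" for f
      unfolding mean using product_mixture_invariant[OF F_inv, of \<rho>L \<rho>R] by (simp add: pmf_\<mu>)
  qed
  have unique: "\<nu> = \<mu>" if \<nu>: "?stat \<nu>" for \<nu>
  proof -
    let ?\<sigma> = "\<lambda>I. pmf \<nu> (ind I) - pmf \<mu> (ind I)"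
    have inv: "(\<Sum>I\<in>Pow V. pmf \<kappa> (ind I) * set_generator \<rho>L \<rho>R g I) = 0" if "?stat \<kappa>" for \<kappa> g
      using stationary_imp_generator_mean_zero[OF finite_sep_configs that, of "\<lambda>\<eta>. g {x. \<eta> x = 1}"]
      unfolding mean by simp
    have total: "(\<Sum>I\<in>Pow V. pmf \<kappa> (ind I)) = 1" if "?stat \<kappa>" for \<kappa>
      using that finite_sep_configs unfolding sum_sep_configs[symmetric] stationary_distribution_def
      by (intro sum_pmf_eq_1) auto
    have "?\<sigma> I = 0" if "I \<subseteq> V" for I
    proof (rule invariant_signed_measure_zero[of \<rho>L \<rho>R ?\<sigma> I])
      show "(\<Sum>I\<in>Pow V. ?\<sigma> I * set_generator \<rho>L \<rho>R g I) = 0" for g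
        using inv[OF \<nu>] inv[OF stat_\<mu>] by (simp add: left_diff_distrib sum_subtractf)
      show "(\<Sum>I\<in>Pow V. ?\<sigma> I) = 0"
        using total[OF \<nu>] total[OF stat_\<mu>] by (simp add: sum_subtractf)
    qed (use assms that in auto)
    then have "pmf \<nu> \<eta> = pmf \<mu> \<eta>" if "\<eta> \<in> sep_configs N" for \<eta>
      using that by (auto simp: sep_configs_eq)
    moreover have "pmf \<kappa> \<eta> = 0" if "?stat \<kappa>" "\<eta> \<notin> sep_configs N" for \<kappa> \<eta>
      using that unfolding stationary_distribution_def by (auto simp: set_pmf_iff)
    ultimately show ?thesis using \<nu> stat_\<mu> by (intro pmf_eqI) metis
  qed
  show ?thesis
    unfolding F_def[symmetric] V_def[symmetric]
  proof (intro conjI allI impI)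
    show "\<exists>!\<mu>. ?stat \<mu>" using stat_\<mu> unique by (rule ex1I)
    show "measure_pmf.prob \<nu> A
        = (\<Sum>I\<in>Pow V. F I * measure_pmf.prob (bernoulli_product N \<rho>L \<rho>R I) A)" if "?stat \<nu>" for \<nu> A
      unfolding unique[OF that] by (rule prob_\<mu>)
  qed (rule F_pos, rule F_sum)
qed

end
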